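(* Fix $\alpha,\beta>-1$. For $n\ge0$ let $$\widetilde P_n^{\alpha,\beta}(x)=(-1)^n\frac{2^{-n}}{n!}(1-x)^{\alpha}(1+x)^{\beta}\frac{d^n}{dx^n}\big((1-x)^{-\alpha+n}(1+x)^{-\beta+n}\big),\qquad x\in(-1,1),$$ which is a polynomial in $x$. Then the function $$\omega(x,t)=\frac{\big(1-t+(1-2xt+t^2)^{1/2}\big)^{\alpha}\big(1+t+(1-2xt+t^2)^{1/2}\big)^{\beta}}{2^{\alpha+\beta}(1-2xt+t^2)^{1/2}},\qquad x\in(-1,1),\ t\in\mathbb{C},\ |t|<1,$$ is a generating function of the family $\{\widetilde P_n^{\alpha,\beta}\}_{n\ge0}$, i.e. $\omega(x,t)=\sum_{n=0}^\infty\widetilde P_n^{\alpha,\beta}(x)t^n$, and the recurrence relation $$2(n+1)(n-\alpha-\beta+1)(2n-\alpha-\beta)\widetilde P_{n+1}^{\alpha,\beta}-(2n-\alpha-\beta+1)\big[(2n-\alpha-\beta+2)(2n-\alpha-\beta)x+\alpha^2-\beta^2\big]\widetilde P_n^{\alpha,\beta}+2(n-\alpha)(n-\beta)(2n-\alpha-\beta+2)\widetilde P_{n-1}^{\alpha,\beta}=0,\quad n\ge1,$$ $$\widetilde P_0^{\alpha,\beta}(x)=1,\qquad \widetilde P_{-1}^{\alpha,\beta}(x)=0,$$ is satisfied (with $\widetilde P_{-1}^{\alpha,\beta}:=0$). Let $$\widetilde{\mathcal G}_{\alpha,\beta}=(1-x^2)\frac{d^2}{dx^2}+\big((\alpha-\beta)+(\alpha+\beta-2)x\big)\frac{d}{dx}.$$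 Then $\widetilde{\mathcal G}_{\alpha,\beta}$ is formally self-adjoint with respect to the inverse Jacobi measure $d\mu_{-\alpha,-\beta}(x)=(1-x)^{-\alpha}(1+x)^{-\beta}dx$ on $(-1,1)$. Moreover, $\widetilde{\mathcal G}_{\alpha,\beta}\widetilde P_n^{\alpha,\beta}=-n(n-\alpha-\beta+1)\widetilde P_n^{\alpha,\beta}$ for all $n\ge0$.
   Context: A second order differential operator $T$ on an open interval $I$ is formally self-adjoint with respect to a measure $\mu$ on $I$ if $\int_I (Tf)\,g\,d\mu=\int_I f\,(Tg)\,d\mu$ for all smooth functions $f,g$ with compact support in $I$. In the generating function, the powers denote the analytic branches on $|t|<1$ for which $(1-2xt+t^2)^{1/2}=1$ at $t=0$ and the two bracketed powers equal $2^\alpha$ and $2^\beta$ at $t=0$. *)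

theory Defs
  imports "HOL-Complex_Analysis.Complex_Analysis" "HOL-Computational_Algebra.Polynomial"
begin

text \<open>The Rodrigues formula, to be used for \<open>x \<in> {-1<..<1}\<close>, where both bases are positive
  and all the derivatives exist.\<close>

definition inv_jacobi :: "real \<Rightarrow> real \<Rightarrow> nat \<Rightarrow> real \<Rightarrow> real" where
  "inv_jacobi \<alpha> \<beta> n x =
     (-1) ^ n * (2 powr (- real n) / fact n) * (1 - x) powr \<alpha> * (1 + x) powr \<beta> *
     (deriv ^^ n) (\<lambda>y. (1 - y) powr (- \<alpha> + real n) * (1 + y) powr (- \<beta> + real n)) x"

text \<open>The same family with the convention that members of negative index vanish.\<close>

definition inv_jacobi_ext :: "real \<Rightarrow> real \<Rightarrow> int \<Rightarrow> real \<Rightarrow> real" where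
  "inv_jacobi_ext \<alpha> \<beta> k x = (if k < 0 then 0 else inv_jacobi \<alpha> \<beta> (nat k) x)"

text \<open>The analytic branch on the unit disc of \<open>h\<^sup>a\<close> with value \<open>c\<close> at \<open>0\<close>. A branch is
  \<open>exp (a * L)\<close> for a holomorphic logarithm \<open>L\<close> of \<open>h\<close>. Two logarithms differ by a constant,
  so the normalisation at \<open>0\<close> (for \<open>c \<noteq> 0\<close>) determines the branch, although it need not
  determine \<open>L\<close>.\<close>

definition power_branch :: "(complex \<Rightarrow> complex) \<Rightarrow> real \<Rightarrow> real \<Rightarrow> complex \<Rightarrow> complex" where
  "power_branch h a c t =
     (THE w. \<exists>L. L holomorphic_on ball 0 1 \<and> (\<forall>s\<in>ball 0 1. exp (L s) = h s) \<and>
                 exp (of_real a * L 0) = of_real c \<and> w = exp (of_real a * L t))"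

definition sqrt_branch :: "real \<Rightarrow> complex \<Rightarrow> complex" where
  "sqrt_branch x = power_branch (\<lambda>t. 1 - 2 * of_real x * t + t ^ 2) (1 / 2) 1"

definition omega :: "real \<Rightarrow> real \<Rightarrow> real \<Rightarrow> complex \<Rightarrow> complex" where
  "omega \<alpha> \<beta> x t =
     power_branch (\<lambda>s. 1 - s + sqrt_branch x s) \<alpha> (2 powr \<alpha>) t *
     power_branch (\<lambda>s. 1 + s + sqrt_branch x s) \<beta> (2 powr \<beta>) t /
     (of_real (2 powr (\<alpha> + \<beta>)) * sqrt_branch x t)"

definition inv_jacobi_op :: "real \<Rightarrow> real \<Rightarrow> (real \<Rightarrow> real) \<Rightarrow> real \<Rightarrow> real" where
  "inv_jacobi_op \<alpha> \<beta> f x =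
     (1 - x ^ 2) * deriv (deriv f) x + ((\<alpha> - \<beta>) + (\<alpha> + \<beta> - 2) * x) * deriv f x"

definition jacobi_measure :: "real \<Rightarrow> real \<Rightarrow> real measure" where
  "jacobi_measure a b =
     density lborel (\<lambda>x. ennreal (indicator {-1<..<1} x * ((1 - x) powr a * (1 + x) powr b)))"

text \<open>Smooth functions with compact support in \<open>I\<close>, as functions on the whole line
  (extended by zero).\<close>

definition test_function :: "real set \<Rightarrow> (real \<Rightarrow> real) \<Rightarrow> bool" where
  "test_function I f \<longleftrightarrow>
     (\<forall>n. (deriv ^^ n) f differentiable_on UNIV) \<and>
     compact (closure {x. f x \<noteq> 0}) \<and> closure {x. f x \<noteq> 0} \<subseteq> I"

text \<open>Integrability is required explicitly because the integral of a non-integrable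
  function is \<open>0\<close> by convention.\<close>

definition formally_self_adjoint ::
    "((real \<Rightarrow> real) \<Rightarrow> real \<Rightarrow> real) \<Rightarrow> real set \<Rightarrow> real measure \<Rightarrow> bool" where
  "formally_self_adjoint T I \<mu> \<longleftrightarrow>
     (\<forall>f g. test_function I f \<longrightarrow> test_function I g \<longrightarrow>
        set_integrable \<mu> I (\<lambda>x. T f x * g x) \<and>
        set_integrable \<mu> I (\<lambda>x. f x * T g x) \<and>
        (LINT x:I|\<mu>. T f x * g x) = (LINT x:I|\<mu>. f x * T g x))"

end

theory Submission
  imports Defs
begin

text \<open>
  For real \<open>\<alpha>\<close>, \<open>\<beta>\<close> the functions in question are the Jacobi polynomials with parameters \<open>-\<alpha>\<close>, \<open>-\<beta>\<close>. The claims
  about them come from three descriptions.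

  Differentiating \<open>v = (1 - y)\<^sup>A (1 + y)\<^sup>B\<close> repeatedly produces the weight with lowered exponents times a
  polynomial, which shows that the Rodrigues formula defines a polynomial. The first-order
  equation of \<open>v\<close> makes the derivative of the \<open>k\<close>-th polynomial factor a multiple of the previous one
  (\<open>pderiv_rodrigues_poly\<close>); together with the recursion this is the eigenvalue equation
  (\<open>inv_jacobi_eigenfunction\<close>).

  Cauchy's formula turns the Rodrigues formula into an integral over a small circle around \<open>x\<close>,
  \<open>w(x) P\<^sub>n(x) = 1 / (2 \<pi> \<i>) \<ointegral> w(z) ((z\<^sup>2 - 1) / 2)\<^sup>n / (z - x)\<^bsup>n + 1\<^esup> dz\<close> with \<open>w(z) = (1 - z)\<^bsup>-\<alpha>\<^esup> (1 + z)\<^bsup>-\<beta>\<^esup>\<close>,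
  so the generating series is a geometric series under the integral sign, with sum
  \<open>w(z) / (z - x - t (z\<^sup>2 - 1) / 2)\<close>. The denominator is quadratic and has one root inside the circle,
  whose residue is \<open>w(x) \<omega>\<close> (\<open>inv_jacobi_generating_near_0\<close>). This holds for small \<open>t\<close>;
  since \<open>\<omega>\<close> is holomorphic in the unit disc, it extends to \<open>\<bar>t\<bar> < 1\<close>.

  The function \<open>\<omega>\<close>, together with \<open>R \<omega>\<close> where \<open>R\<close> is the square root, solves a first-order linear system in \<open>t\<close>
  with polynomial coefficients (\<open>genfun_system_1\<close>, \<open>genfun_system_2\<close>). Comparing coefficients and eliminating those of \<open>R \<omega>\<close> is the
  three-term recurrence (\<open>inv_jacobi_recurrence\<close>).

  Self-adjointness is independent of the polynomials: the operator has Sturm--Liouville form with respect to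
  the inverse Jacobi weight, and the boundary terms vanish for compactly supported functions.
\<close>

section \<open>The Rodrigues formula and the eigenvalue equation\<close>

text \<open>The polynomial factor that remains when the \<open>k\<close>-th derivative of
  \<open>(1 - y)\<^sup>A (1 + y)\<^sup>B\<close> is divided by \<open>(1 - y)\<^bsup>A - k\<^esup> (1 + y)\<^bsup>B - k\<^esup>\<close>; the recursion is the product rule.\<close>
primrec rodrigues_poly :: "real \<Rightarrow> real \<Rightarrow> nat \<Rightarrow> real poly" where
  "rodrigues_poly A B 0 = 1"
| "rodrigues_poly A B (Suc k) =
     [:1, 0, -1:] * pderiv (rodrigues_poly A B k) + [:B - A, 2 * real k - A - B:] * rodrigues_poly A B k"

lemma higher_deriv_jacobi_weight:
  fixes A B y :: real
  assumes "y \<in> {-1<..<1}"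
  shows "(deriv ^^ k) (\<lambda>y. (1 - y) powr A * (1 + y) powr B) y =
           (1 - y) powr (A - real k) * (1 + y) powr (B - real k) * poly (rodrigues_poly A B k) y"
  using assms
proof (induction k arbitrary: y)
  case 0
  then show ?case by simp
next
  case (Suc k)
  define f where "f = (\<lambda>y. (1 - y) powr (A - real k) * (1 + y) powr (B - real k)
                            * poly (rodrigues_poly A B k) y)"
  have "eventually (\<lambda>y. y \<in> {-1<..<1::real}) (nhds y)"
    using Suc.prems by (intro eventually_nhds_in_open) auto
  then have "eventually (\<lambda>y. (deriv ^^ k) (\<lambda>y. (1 - y) powr A * (1 + y) powr B) y = f y) (nhds y)"
    by eventually_elim (use Suc.IH in \<open>auto simp: f_def\<close>)
  then have "(deriv ^^ Suc k) (\<lambda>y. (1 - y) powr A * (1 + y) powr B) y = deriv f y"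
    by (simp add: deriv_cong_ev)
  also have "deriv f y = (1 - y) powr (A - real (Suc k)) * (1 + y) powr (B - real (Suc k))
                           * poly (rodrigues_poly A B (Suc k)) y"
  proof (rule DERIV_imp_deriv)
    have pos: "1 - y > 0" "1 + y > 0" using Suc.prems by auto
    have *: "u powr (C - real k) = u powr (C - real (Suc k)) * u" if "u > 0" for u C :: real
      using powr_add[of u "C - real (Suc k)" 1] that by (simp add: algebra_simps)
    have **: "u powr (C - real k - 1) = u powr (C - real (Suc k))" for u C :: real
      by (simp add: algebra_simps)
    show "(f has_real_derivative (1 - y) powr (A - real (Suc k)) * (1 + y) powr (B - real (Suc k))
                           * poly (rodrigues_poly A B (Suc k)) y) (at y)"
      unfolding f_def
      by (rule derivative_eq_intros poly_DERIV refl pos)+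
         (use pos in \<open>simp only: *[OF pos(1)] *[OF pos(2)] **, simp add: field_simps del: of_nat_Suc\<close>)
  qed
  finally show ?case .
qed

text \<open>The weight \<open>v = (1 - y)\<^sup>A (1 + y)\<^sup>B\<close> satisfies the first-order equation
  \<open>(1 - y\<^sup>2) v' = (B - A - (A + B) y) v\<close>. Differentiating it repeatedly gives a linear relation between
  three consecutive derivatives of \<open>v\<close>; for the polynomial factors, whose recursion already
  involves a derivative, that relation collapses to an Appell-type rule: differentiation lowers the index
  and multiplies by a constant. The induction replaces the derivative of the \<open>k\<close>-th polynomial
  by means of the recursion itself.\<close>
lemma pderiv_rodrigues_poly:
  "pderiv (rodrigues_poly A B (Suc k)) = smult (- real (Suc k) * (A + B - real k)) (rodrigues_poly A B k)"
proof -
  have "poly (pderiv (rodrigues_poly A B (Suc k))) y =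
          - real (Suc k) * (A + B - real k) * poly (rodrigues_poly A B k) y" for y
  proof (induction k arbitrary: y)
    case 0
    show ?case by (simp add: pderiv_add pderiv_mult pderiv_pCons)
  next
    case (Suc k)
    define p where "p = rodrigues_poly A B"
    define c where "c = - real (Suc k) * (A + B - real k)"
    have IH: "pderiv (p (Suc k)) = smult c (p k)"
      using Suc.IH by (simp add: p_def c_def fun_eq_iff flip: poly_eq_poly_eq_iff)
    have rec: "p (Suc (Suc k)) = [:1, 0, -1:] * pderiv (p (Suc k)) + [:B - A, 2 * real (Suc k) - A - B:] * p (Suc k)"
      "p (Suc k) = [:1, 0, -1:] * pderiv (p k) + [:B - A, 2 * real k - A - B:] * p k"
      by (simp_all only: p_def rodrigues_poly.simps)
    have r2: "(1 - y\<^sup>2) * poly (pderiv (p k)) y = poly (p (Suc k)) y - (B - A + (2 * real k - A - B) * y) * poly (p k) y"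
      by (subst rec(2)) (simp add: algebra_simps power2_eq_square)
    have "poly (pderiv (p (Suc (Suc k)))) y =
       c * ((1 - y\<^sup>2) * poly (pderiv (p k)) y) - 2 * y * c * poly (p k) y
       + (B - A + (2 * real (Suc k) - A - B) * y) * c * poly (p k) y
       + (2 * real (Suc k) - A - B) * poly (p (Suc k)) y"
      unfolding rec(1) IH
      by (simp add: pderiv_add pderiv_minus pderiv_mult pderiv_pCons pderiv_smult IH algebra_simps power2_eq_square)
    also have "\<dots> = - real (Suc (Suc k)) * (A + B - real (Suc k)) * poly (p (Suc k)) y"
      unfolding r2 by (simp add: c_def algebra_simps)
    finally show ?case by (simp only: p_def)
  qed
  then show ?thesis by (simp add: fun_eq_iff flip: poly_eq_poly_eq_iff)
qed

text \<open>Inserting the derivative rule for the \<open>k\<close>-th polynomial into the recursion that defines it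
  from its predecessor yields a second-order equation for the \<open>k\<close>-th polynomial alone.\<close>
lemma rodrigues_poly_ode:
  "(1 - y\<^sup>2) * poly (pderiv (pderiv (rodrigues_poly A B k))) y
     + (B - A + (2 * real k - 2 - A - B) * y) * poly (pderiv (rodrigues_poly A B k)) y
   = - real k * (A + B - real k + 1) * poly (rodrigues_poly A B k) y"
proof (cases k)
  case (Suc j)
  have "poly (rodrigues_poly A B k) y = (1 - y\<^sup>2) * poly (pderiv (rodrigues_poly A B j)) y
          + (B - A + (2 * real j - A - B) * y) * poly (rodrigues_poly A B j) y"
    by (simp add: Suc algebra_simps power2_eq_square)
  then show ?thesis
    unfolding Suc pderiv_rodrigues_poly pderiv_smult
    by (simp add: algebra_simps power2_eq_square)
qed simp

lemma inv_jacobi_eq_poly: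
  assumes "x \<in> {-1<..<1}"
  shows "inv_jacobi \<alpha> \<beta> n x = poly (smult ((-1) ^ n * (2 powr (- real n) / fact n))
           (rodrigues_poly (real n - \<alpha>) (real n - \<beta>) n)) x"
proof -
  have *: "(1 - x) powr \<alpha> * (1 - x) powr (- \<alpha>) = 1" "(1 + x) powr \<beta> * (1 + x) powr (- \<beta>) = 1"
    using assms by (simp_all flip: powr_add)
  have "inv_jacobi \<alpha> \<beta> n x = ((-1) ^ n * (2 powr (- real n) / fact n)) *
          ((1 - x) powr \<alpha> * (1 - x) powr (- \<alpha>)) * ((1 + x) powr \<beta> * (1 + x) powr (- \<beta>)) *
          poly (rodrigues_poly (real n - \<alpha>) (real n - \<beta>) n) x"
    unfolding inv_jacobi_def higher_deriv_jacobi_weight[OF assms]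
    by (simp del: powr_minus)
  then show ?thesis unfolding * by simp
qed

text \<open>The eigenvalue equation is the differential equation of the polynomial factor with \<open>A = n - \<alpha>\<close>, \<open>B = n - \<beta>\<close> and \<open>k = n\<close>: then
  the first-order coefficient \<open>B - A + (2 n - 2 - A - B) x\<close> loses its dependence on \<open>n\<close>.\<close>
lemma inv_jacobi_eigenfunction:
  assumes x: "x \<in> {-1<..<1}"
  shows "inv_jacobi_op \<alpha> \<beta> (inv_jacobi \<alpha> \<beta> n) x
         = - real n * (real n - \<alpha> - \<beta> + 1) * inv_jacobi \<alpha> \<beta> n x"
proof -
  define p where "p = rodrigues_poly (real n - \<alpha>) (real n - \<beta>) n"
  define c :: real where "c = (-1) ^ n * (2 powr (- real n) / fact n)"
  have deriv_poly: "deriv (poly q) = poly (pderiv q)" for q :: "real poly"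
    by (intro ext DERIV_imp_deriv poly_DERIV)
  have near: "eventually (\<lambda>y. y \<in> {-1<..<1::real}) (nhds y)" if "y \<in> {-1<..<1}" for y
    using that by (intro eventually_nhds_in_open) auto
  have 0: "deriv (inv_jacobi \<alpha> \<beta> n) y = poly (pderiv (smult c p)) y" if y: "y \<in> {-1<..<1}" for y
  proof -
    have "eventually (\<lambda>y. inv_jacobi \<alpha> \<beta> n y = poly (smult c p) y) (nhds y)"
      using near[OF y] by eventually_elim (simp only: inv_jacobi_eq_poly p_def c_def)
    then have "deriv (inv_jacobi \<alpha> \<beta> n) y = deriv (poly (smult c p)) y"
      by (intro deriv_cong_ev refl)
    then show ?thesis by (simp only: deriv_poly)
  qed
  have "eventually (\<lambda>y. deriv (inv_jacobi \<alpha> \<beta> n) y = poly (pderiv (smult c p)) y) (nhds x)"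
    using near[OF x] by eventually_elim (simp only: 0)
  then have 1: "deriv (deriv (inv_jacobi \<alpha> \<beta> n)) x = poly (pderiv (pderiv (smult c p))) x"
    by (simp only: deriv_cong_ev deriv_poly)
  have "inv_jacobi_op \<alpha> \<beta> (inv_jacobi \<alpha> \<beta> n) x = c * ((1 - x\<^sup>2) * poly (pderiv (pderiv p)) x
      + ((real n - \<beta>) - (real n - \<alpha>) + (2 * real n - 2 - (real n - \<alpha>) - (real n - \<beta>)) * x) * poly (pderiv p) x)"
    unfolding inv_jacobi_op_def 0[OF x] 1 by (simp add: pderiv_smult algebra_simps)
  also have "\<dots> = c * (- real n * (real n - \<alpha> - \<beta> + 1) * poly p x)"
    unfolding p_def rodrigues_poly_ode by (simp add: algebra_simps)
  finally show ?thesis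
    by (simp add: inv_jacobi_eq_poly[OF x] p_def c_def)
qed

section \<open>The branches in the generating function\<close>

text \<open>Two holomorphic logarithms of the same function differ by a constant because their difference
  has constant exponential and hence zero derivative. The constant changes \<open>exp (a L)\<close> by a factor, which the value at
  \<open>0\<close> forces to be \<open>1\<close>. So any one logarithm with the right value computes the branch.\<close>
lemma power_branch_eqI:
  assumes L: "L holomorphic_on ball 0 1" "\<And>s. s \<in> ball 0 1 \<Longrightarrow> exp (L s) = h s"
      and c: "exp (of_real a * L 0) = of_real c" and t: "t \<in> ball 0 1"
  shows "power_branch h a c t = exp (of_real a * L t)"
  unfolding power_branch_def
proof (rule the_equality)
  show "\<exists>M. M holomorphic_on ball 0 1 \<and> (\<forall>s\<in>ball 0 1. exp (M s) = h s) \<and>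
          exp (of_real a * M 0) = of_real c \<and> exp (of_real a * L t) = exp (of_real a * M t)"
    using assms by blast
next
  fix w
  assume "\<exists>M. M holomorphic_on ball 0 1 \<and> (\<forall>s\<in>ball 0 1. exp (M s) = h s) \<and>
            exp (of_real a * M 0) = of_real c \<and> w = exp (of_real a * M t)"
  then obtain M where M: "M holomorphic_on ball 0 1" "\<And>s. s \<in> ball 0 1 \<Longrightarrow> exp (M s) = h s"
    "exp (of_real a * M 0) = of_real c" "w = exp (of_real a * M t)"
    by blast
  define K where "K = (\<lambda>s. L s - M s)"
  have K: "K holomorphic_on ball 0 1"
    unfolding K_def by (intro holomorphic_intros L M)
  have expK: "exp (K s) = 1" if "s \<in> ball 0 1" for s
    using L(2)[OF that] M(2)[OF that] exp_not_eq_zero[of "M s"] by (simp add: K_def exp_diff)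
  have "\<exists>d. \<forall>s\<in>ball 0 1. K s = d"
  proof (rule has_field_derivative_zero_constant)
    fix s :: complex assume s: "s \<in> ball 0 1"
    have dK: "(K has_field_derivative deriv K s) (at s)"
      using K s by (intro holomorphic_derivI) auto
    have "((\<lambda>u. exp (K u)) has_field_derivative exp (K s) * deriv K s) (at s)"
      by (rule derivative_eq_intros dK refl)+
    moreover have "((\<lambda>u. exp (K u)) has_field_derivative 0) (at s)"
    proof (rule has_field_derivative_transform_within_open[where S = "ball 0 1"])
      show "((\<lambda>_. 1) has_field_derivative 0) (at s)" by simp
    qed (use s expK in auto)
    ultimately have "exp (K s) * deriv K s = 0"
      by (rule DERIV_unique)
    then show "(K has_field_derivative 0) (at s within ball 0 1)"
      using dK by (auto intro: has_field_derivative_at_within)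
  qed simp
  then have "L t - M t = L 0 - M 0"
    using t unfolding K_def by (metis centre_in_ball zero_less_one)
  then have "exp (of_real a * (L t - M t)) = exp (of_real a * (L 0 - M 0))"
    by (rule arg_cong)
  also have "\<dots> = 1"
    using exp_not_eq_zero[of "of_real a * L 0"] unfolding right_diff_distrib
    by (simp only: exp_diff c M(3) divide_self not_False_eq_True)
  finally show "w = exp (of_real a * L t)"
    using M(4) by (simp add: right_diff_distrib exp_diff)
qed

lemma holomorphic_log_on_ball_with_value:
  assumes h: "h holomorphic_on ball 0 1" "\<And>s. s \<in> ball 0 1 \<Longrightarrow> h s \<noteq> 0" and c: "exp c = h 0"
  obtains L where "L holomorphic_on ball 0 1" "\<And>s. s \<in> ball 0 1 \<Longrightarrow> exp (L s) = h s" "L 0 = c"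
proof -
  obtain L0 where L0: "L0 holomorphic_on ball 0 1" "\<And>s. s \<in> ball 0 1 \<Longrightarrow> h s = exp (L0 s)"
    using contractible_imp_holomorphic_log[OF h(1) _ h(2)] convex_imp_contractible[OF convex_ball] by metis
  show thesis
  proof
    show "(\<lambda>s. L0 s + (c - L0 0)) holomorphic_on ball 0 1"
      by (intro holomorphic_intros L0)
    show "exp (L0 s + (c - L0 0)) = h s" if "s \<in> ball 0 1" for s
      using L0(2)[OF that] L0(2)[of 0] c by (simp add: exp_add exp_diff)
  qed simp
qed

text \<open>The zeros of \<open>1 - 2 x t + t\<^sup>2\<close> are \<open>x \<plusminus> \<i> sqrt (1 - x\<^sup>2)\<close>, which lie on the unit circle.\<close>
lemma discriminant_nonzero:
  fixes x :: real and t :: complex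
  assumes "\<bar>x\<bar> < 1" "norm t < 1"
  shows "1 - 2 * of_real x * t + t\<^sup>2 \<noteq> 0"
proof
  assume *: "1 - 2 * of_real x * t + t\<^sup>2 = 0"
  define u v where "u = Re t" and "v = Im t"
  have re: "1 - 2 * x * u + u\<^sup>2 - v\<^sup>2 = 0" and im: "v * (u - x) = 0"
    using arg_cong[OF *, of Re] arg_cong[OF *, of Im]
    by (auto simp: u_def v_def power2_eq_square algebra_simps)
  have x2: "x\<^sup>2 < 1" using assms(1) by (simp add: abs_square_less_1)
  have "u\<^sup>2 + v\<^sup>2 < 1"
    using assms(2) by (simp add: u_def v_def cmod_def)
  moreover have "v \<noteq> 0"
  proof
    assume "v = 0"
    then have "(u - x)\<^sup>2 + (1 - x\<^sup>2) = 0" using re by (simp add: power2_eq_square algebra_simps)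
    then show False using x2 zero_le_power2[of "u - x"] by linarith
  qed
  ultimately show False
    using re im by (auto simp: power2_eq_square)
qed

text \<open>A choice of the square root \<open>R\<close> and of logarithms \<open>L1\<close>, \<open>L2\<close> of the two bracketed functions. The
  real normalisation \<open>ln 2\<close> at \<open>0\<close> makes \<open>exp (a (L1 - ln 2))\<close> the branch of \<open>((1 - t + R) / 2)\<^sup>a\<close> with value \<open>1\<close>
  at \<open>0\<close>, whatever \<open>a\<close> is.\<close>
locale omega_branches =
  fixes x :: real and R L1 L2 :: "complex \<Rightarrow> complex"
  assumes x: "x \<in> {-1<..<1}"
      and R_holo: "R holomorphic_on ball 0 1" and R_0: "R 0 = 1"
      and R_sq: "\<And>t. t \<in> ball 0 1 \<Longrightarrow> (R t)\<^sup>2 = 1 - 2 * of_real x * t + t\<^sup>2"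
      and L1_holo: "L1 holomorphic_on ball 0 1" and L1_0: "L1 0 = of_real (ln 2)"
      and exp_L1: "\<And>t. t \<in> ball 0 1 \<Longrightarrow> exp (L1 t) = 1 - t + R t"
      and L2_holo: "L2 holomorphic_on ball 0 1" and L2_0: "L2 0 = of_real (ln 2)"
      and exp_L2: "\<And>t. t \<in> ball 0 1 \<Longrightarrow> exp (L2 t) = 1 + t + R t"
begin

definition genfun :: "real \<Rightarrow> real \<Rightarrow> complex \<Rightarrow> complex" where
  "genfun \<alpha> \<beta> t = exp (of_real \<alpha> * (L1 t - of_real (ln 2))) * exp (of_real \<beta> * (L2 t - of_real (ln 2))) / R t"

lemma R_nonzero: "t \<in> ball 0 1 \<Longrightarrow> R t \<noteq> 0"
  using R_sq[of t] discriminant_nonzero[of x t] x by (auto simp: abs_if split: if_splits)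

lemma genfun_holo: "genfun \<alpha> \<beta> holomorphic_on ball 0 1"
  unfolding genfun_def by (intro holomorphic_intros R_holo L1_holo L2_holo R_nonzero)

end

text \<open>The brackets do not vanish: \<open>R = \<plusminus>t - 1\<close> would give \<open>R\<^sup>2 = (1 \<mp> t)\<^sup>2\<close>, that is
  \<open>2 t (\<plusminus>1 - x) = 0\<close>, hence \<open>t = 0\<close>, where the brackets have the value \<open>2\<close>.\<close>
lemma omega_branches_exist:
  assumes x: "x \<in> {-1<..<1}"
  obtains R L1 L2 where "omega_branches x R L1 L2"
    "\<And>\<alpha> \<beta> t. t \<in> ball 0 1 \<Longrightarrow> omega \<alpha> \<beta> x t = omega_branches.genfun R L1 L2 \<alpha> \<beta> t"
proof -
  have "\<bar>x\<bar> < 1" using x by auto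
  obtain L0 where L0: "L0 holomorphic_on ball 0 1" "L0 0 = 0"
    "\<And>s. s \<in> ball 0 1 \<Longrightarrow> exp (L0 s) = 1 - 2 * of_real x * s + s\<^sup>2"
    by (rule holomorphic_log_on_ball_with_value[of "\<lambda>s. 1 - 2 * of_real x * s + s\<^sup>2" 0])
       (use discriminant_nonzero[OF \<open>\<bar>x\<bar> < 1\<close>] in \<open>auto intro!: holomorphic_intros\<close>)
  define R where "R = (\<lambda>s. exp (L0 s / 2))"
  have R: "R holomorphic_on ball 0 1" "R 0 = 1"
    unfolding R_def using L0(2) by (auto intro!: holomorphic_intros L0(1))
  have R_sq: "(R s)\<^sup>2 = 1 - 2 * of_real x * s + s\<^sup>2" if "s \<in> ball 0 1" for s
    using L0(3)[OF that] by (simp add: R_def flip: exp_double)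
  have sqrt: "sqrt_branch x s = R s" if "s \<in> ball 0 1" for s
    unfolding sqrt_branch_def
    by (subst power_branch_eqI[OF L0(1,3)]) (use L0(2) that in \<open>auto simp: R_def\<close>)
  \<comment> \<open>The sign \<open>e\<close> treats both brackets at once.\<close>
  have ne: "1 - e * s + R s \<noteq> 0" if s: "s \<in> ball 0 1" and e: "e = 1 \<or> e = -1" for s e
  proof
    assume "1 - e * s + R s = 0"
    then have R_eq: "R s = e * s - 1" by (simp add: algebra_simps add_eq_0_iff)
    have "e\<^sup>2 = 1" using e by auto
    then have "2 * s * (e - of_real x) = 1 - 2 * of_real x * s + s\<^sup>2 - (e * s - 1)\<^sup>2"
      by (simp add: power2_diff power_mult_distrib algebra_simps)
    also have "\<dots> = 0"
      using R_sq[OF s] by (simp add: R_eq)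
    finally have "2 * s * (e - of_real x) = 0" .
    moreover have "e \<noteq> of_real x"
      using e x by (auto simp: complex_eq_iff)
    ultimately have "s = 0" by simp
    with \<open>1 - e * s + R s = 0\<close> R(2) show False by simp
  qed
  have ln2: "exp (of_real (ln 2)) = (2 :: complex)"
    by (metis exp_ln exp_of_real of_real_numeral zero_less_numeral)
  obtain L1 where L1: "L1 holomorphic_on ball 0 1" "L1 0 = of_real (ln 2)"
    "\<And>s. s \<in> ball 0 1 \<Longrightarrow> exp (L1 s) = 1 - s + R s"
    by (rule holomorphic_log_on_ball_with_value[of "\<lambda>s. 1 - s + R s" "of_real (ln 2)"])
       (use ne[of _ 1] R ln2 in \<open>auto intro!: holomorphic_intros\<close>)
  obtain L2 where L2: "L2 holomorphic_on ball 0 1" "L2 0 = of_real (ln 2)"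
    "\<And>s. s \<in> ball 0 1 \<Longrightarrow> exp (L2 s) = 1 + s + R s"
    by (rule holomorphic_log_on_ball_with_value[of "\<lambda>s. 1 + s + R s" "of_real (ln 2)"])
       (use ne[of _ "-1"] R ln2 in \<open>auto intro!: holomorphic_intros\<close>)
  interpret omega_branches x R L1 L2
    by unfold_locales (use x R R_sq L1 L2 in auto)
  have two_powr: "exp (of_real a * of_real (ln 2)) = of_real (2 powr a)" for a :: real
    unfolding of_real_mult[symmetric] exp_of_real by (simp add: powr_def)
  show thesis
  proof
    show "omega_branches x R L1 L2" ..
    fix \<alpha> \<beta> :: real and t :: complex assume t: "t \<in> ball 0 1"
    have "power_branch (\<lambda>s. 1 - s + sqrt_branch x s) \<alpha> (2 powr \<alpha>) t = exp (of_real \<alpha> * L1 t)"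
      by (rule power_branch_eqI[OF L1(1)]) (use L1 t two_powr in \<open>auto simp: sqrt\<close>)
    moreover have "power_branch (\<lambda>s. 1 + s + sqrt_branch x s) \<beta> (2 powr \<beta>) t = exp (of_real \<beta> * L2 t)"
      by (rule power_branch_eqI[OF L2(1)]) (use L2 t two_powr in \<open>auto simp: sqrt\<close>)
    ultimately show "omega \<alpha> \<beta> x t = genfun \<alpha> \<beta> t"
      unfolding omega_def genfun_def
      by (simp add: sqrt[OF t] right_diff_distrib exp_diff two_powr powr_add)
  qed
qed

section \<open>The generating series as a contour integral\<close>

text \<open>The Rodrigues formula uses real derivatives and Cauchy's formula complex ones. They agree on the
  real axis, by induction: a complex derivative taken along the real axis of a real-valued function is real.\<close>
lemma higher_deriv_of_real:
  fixes f :: "complex \<Rightarrow> complex" and g :: "real \<Rightarrow> real"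
  assumes f: "f holomorphic_on S" "open S" and T: "open T" "of_real ` T \<subseteq> S"
      and fg: "\<And>y. y \<in> T \<Longrightarrow> f (of_real y) = of_real (g y)" and y: "y \<in> T"
  shows "(deriv ^^ k) f (of_real y) = of_real ((deriv ^^ k) g y)"
  using y
proof (induction k arbitrary: y)
  case 0
  then show ?case by (simp add: fg)
next
  case (Suc k)
  define D where "D = deriv ((deriv ^^ k) f) (of_real y)"
  have "((deriv ^^ k) f has_field_derivative D) (at (of_real y))"
    unfolding D_def using Suc.prems T f by (intro holomorphic_derivI[of _ S] holomorphic_higher_deriv) auto
  then have "((\<lambda>u. (deriv ^^ k) f (of_real u)) has_vector_derivative D) (at y)"
    using has_vector_derivative_real_field by blast
  then have *: "((\<lambda>u. of_real ((deriv ^^ k) g u) :: complex) has_vector_derivative D) (at y)"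
    by (rule has_vector_derivative_transform_within_open[where S = T])
       (use Suc T in auto)
  have re: "((deriv ^^ k) g has_real_derivative Re D) (at y)"
    using bounded_linear.has_vector_derivative[OF bounded_linear_Re *]
    by (simp add: has_real_derivative_iff_has_vector_derivative)
  have "((\<lambda>u. 0) has_real_derivative Im D) (at y)"
    using bounded_linear.has_vector_derivative[OF bounded_linear_Im *]
    by (simp add: has_real_derivative_iff_has_vector_derivative)
  then have "Im D = 0"
    using DERIV_unique DERIV_const by blast
  then show ?case
    using DERIV_imp_deriv[OF re] by (simp add: D_def complex_eq_iff)
qed

definition complex_weight :: "real \<Rightarrow> real \<Rightarrow> complex \<Rightarrow> complex" where
  "complex_weight a b z = (1 - z) powr of_real a * (1 + z) powr of_real b"

lemma unit_ball_in_right_half_planes: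
  assumes "z \<in> ball (0 :: complex) 1"
  shows "Re (1 - z) > 0" "Re (1 + z) > 0" "1 - z \<notin> \<real>\<^sub>\<le>\<^sub>0" "1 + z \<notin> \<real>\<^sub>\<le>\<^sub>0"
proof -
  show "Re (1 - z) > 0" "Re (1 + z) > 0"
    using assms abs_Re_le_cmod[of z] by auto
  then show "1 - z \<notin> \<real>\<^sub>\<le>\<^sub>0" "1 + z \<notin> \<real>\<^sub>\<le>\<^sub>0"
    by (auto simp: complex_nonpos_Reals_iff)
qed

lemma complex_weight_holo: "complex_weight a b holomorphic_on ball 0 1"
  unfolding complex_weight_def using unit_ball_in_right_half_planes by (auto intro!: holomorphic_intros)

lemma complex_weight_of_real:
  assumes "x \<in> {-1<..<1}"
  shows "complex_weight a b (of_real x) = of_real ((1 - x) powr a * (1 + x) powr b)"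
  using assms powr_of_real[of "1 - x" a] powr_of_real[of "1 + x" b] by (simp add: complex_weight_def)

lemma complex_weight_add_nat:
  assumes "z \<in> ball 0 1"
  shows "complex_weight (a + real n) (b + real n) z = complex_weight a b z * (1 - z\<^sup>2) ^ n"
proof -
  have "1 - z \<noteq> 0" "1 + z \<noteq> 0" using unit_ball_in_right_half_planes[OF assms] by auto
  then have "complex_weight (a + real n) (b + real n) z = complex_weight a b z * ((1 - z) * (1 + z)) ^ n"
    by (simp add: complex_weight_def powr_add powr_nat' power_mult_distrib)
  also have "(1 - z) * (1 + z) = 1 - z\<^sup>2" by (simp add: algebra_simps power2_eq_square)
  finally show ?thesis .
qed

text \<open>Cauchy's formula for the derivative in the Rodrigues formula. The point is that the differentiated
  function is the weight times the \<open>n\<close>-th power of \<open>1 - z\<^sup>2\<close>, so that \<open>n\<close> occurs only as an exponent and the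
  integrands form a geometric progression.\<close>
lemma inv_jacobi_contour_integral:
  assumes x: "x \<in> {-1<..<1}" and r: "r > 0" "cball (complex_of_real x) r \<subseteq> ball 0 1"
  shows "((\<lambda>z. complex_weight (-\<alpha>) (-\<beta>) z * ((z\<^sup>2 - 1) / 2) ^ n / (z - of_real x) ^ Suc n)
           has_contour_integral
          2 * of_real pi * \<i> * (complex_weight (-\<alpha>) (-\<beta>) (of_real x) * of_real (inv_jacobi \<alpha> \<beta> n x)))
         (circlepath (of_real x) r)"
proof -
  define F where "F = complex_weight (-\<alpha> + real n) (-\<beta> + real n)"
  define D where "D = (deriv ^^ n) (\<lambda>y. (1 - y) powr (- \<alpha> + real n) * (1 + y) powr (- \<beta> + real n)) x"
  have F: "F holomorphic_on ball 0 1"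
    unfolding F_def by (rule complex_weight_holo)
  have "(deriv ^^ n) F (of_real x) = of_real D"
    unfolding D_def
    by (rule higher_deriv_of_real[OF F open_ball, of "{-1<..<1}"])
       (use x in \<open>auto simp: F_def complex_weight_of_real simp flip: of_real_add\<close>)
  moreover have "((\<lambda>u. F u / (u - of_real x) ^ Suc n) has_contour_integral
      (2 * pi * \<i>) / fact n * (deriv ^^ n) F (of_real x)) (circlepath (of_real x) r)"
  proof (rule Cauchy_has_contour_integral_higher_derivative_circlepath)
    show "F holomorphic_on ball (of_real x) r"
      using F r(2) ball_subset_cball by (blast intro: holomorphic_on_subset)
    show "continuous_on (cball (of_real x) r) F"
      using F r(2) by (blast intro: holomorphic_on_subset holomorphic_on_imp_continuous_on)
  qed (use r in auto)
  ultimately have "((\<lambda>u. (-1/2) ^ n * (F u / (u - of_real x) ^ Suc n)) has_contour_integral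
      (-1/2) ^ n * ((2 * pi * \<i>) / fact n * of_real D)) (circlepath (of_real x) r)"
    by (intro has_contour_integral_lmul) simp
  moreover have "(-1/2) ^ n * ((2 * pi * \<i>) / fact n * of_real D) =
     2 * of_real pi * \<i> * (complex_weight (-\<alpha>) (-\<beta>) (of_real x) * of_real (inv_jacobi \<alpha> \<beta> n x))"
  proof -
    have *: "(1 - x) powr (- \<alpha>) * (1 - x) powr \<alpha> = 1" "(1 + x) powr (- \<beta>) * (1 + x) powr \<beta> = 1"
      using x by (simp_all flip: powr_add)
    have "(1 - x) powr (- \<alpha>) * (1 + x) powr (- \<beta>) * inv_jacobi \<alpha> \<beta> n x =
        ((1 - x) powr (- \<alpha>) * (1 - x) powr \<alpha>) * ((1 + x) powr (- \<beta>) * (1 + x) powr \<beta>) *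
          ((-1) ^ n * (2 powr (- real n) / fact n) * D)"
      unfolding inv_jacobi_def D_def[symmetric] by (simp del: powr_minus)
    also have "\<dots> = (-1) ^ n * (2 powr (- real n) / fact n) * D"
      unfolding * by simp
    also have "\<dots> = (-1/2) ^ n / fact n * D"
      unfolding power_divide by (simp add: powr_minus powr_realpow divide_inverse)
    finally show ?thesis
      unfolding complex_weight_of_real[OF x] of_real_mult[symmetric] by simp
  qed
  ultimately have "((\<lambda>u. (-1/2) ^ n * (F u / (u - of_real x) ^ Suc n)) has_contour_integral
      2 * of_real pi * \<i> * (complex_weight (-\<alpha>) (-\<beta>) (of_real x) * of_real (inv_jacobi \<alpha> \<beta> n x)))
      (circlepath (of_real x) r)" by simp
  then show ?thesis
  proof (rule has_contour_integral_eq)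
    fix z assume "z \<in> path_image (circlepath (complex_of_real x) r)"
    then have z: "z \<in> ball 0 1" using r by (auto simp: sphere_def)
    have "(-1/2) ^ n * (1 - z\<^sup>2) ^ n = ((z\<^sup>2 - 1) / 2) ^ n"
      unfolding power_mult_distrib[symmetric] by (simp add: algebra_simps diff_divide_distrib)
    then show "(-1/2) ^ n * (F z / (z - of_real x) ^ Suc n) =
        complex_weight (-\<alpha>) (-\<beta>) z * ((z\<^sup>2 - 1) / 2) ^ n / (z - of_real x) ^ Suc n"
      unfolding F_def complex_weight_add_nat[OF z] by (simp add: mult_ac)
  qed
qed

text \<open>For small \<open>t\<close> the geometric series of these integrands converges uniformly on the circle, with ratio
  \<open>q = t (z\<^sup>2 - 1) / (2 (z - x))\<close>. The bound on \<open>t\<close> gives \<open>\<bar>q\<bar> \<le> 1/2\<close>, since \<open>\<bar>z\<^sup>2 - 1\<bar> \<le> 2\<close> inside the unit disc.\<close>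
lemma inv_jacobi_sums_contour_integral:
  assumes x: "x \<in> {-1<..<1}" and r: "r > 0" "cball (complex_of_real x) r \<subseteq> ball 0 1" and t: "norm t \<le> r / 2"
  shows "(\<lambda>n. 2 * of_real pi * \<i> * (complex_weight (-\<alpha>) (-\<beta>) (of_real x) * of_real (inv_jacobi \<alpha> \<beta> n x)) * t ^ n)
           sums contour_integral (circlepath (of_real x) r)
             (\<lambda>z. complex_weight (-\<alpha>) (-\<beta>) z / (z - of_real x - t * ((z\<^sup>2 - 1) / 2)))"
proof -
  define H where "H = complex_weight (-\<alpha>) (-\<beta>)"
  define f where "f = (\<lambda>n z. H z * ((z\<^sup>2 - 1) / 2) ^ n / (z - of_real x) ^ Suc n * t ^ n)"
  define q where "q = (\<lambda>z. t * ((z\<^sup>2 - 1) / 2) / (z - of_real x))"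
  have sub: "sphere (of_real x :: complex) r \<subseteq> ball 0 1" using r(2) by auto
  have int: "(f n has_contour_integral
      2 * of_real pi * \<i> * (H (of_real x) * of_real (inv_jacobi \<alpha> \<beta> n x)) * t ^ n) (circlepath (of_real x) r)" for n
    unfolding f_def H_def by (intro has_contour_integral_rmul inv_jacobi_contour_integral x r)
  have "compact (H ` sphere (of_real x) r)"
    unfolding H_def
    by (intro compact_continuous_image holomorphic_on_imp_continuous_on
          holomorphic_on_subset[OF complex_weight_holo sub]) auto
  then obtain B where B: "\<And>z. z \<in> sphere (of_real x) r \<Longrightarrow> norm (H z) \<le> B"
    by (meson bounded_iff compact_imp_bounded imageI)
  have "h * w ^ n / e ^ Suc n * t ^ n = h / e * (t * w / e) ^ n" for h w e :: complex and n
    by (simp add: power_divide power_mult_distrib)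
  then have f_eq: "f n z = H z / (z - of_real x) * q z ^ n" for n z
    unfolding f_def q_def by blast
  have q: "norm (q z) \<le> 1 / 2" if z: "z \<in> sphere (of_real x) r" for z
  proof -
    have "norm z \<le> 1" using sub z by auto
    then have "norm (z\<^sup>2 - 1) \<le> 2"
      using norm_triangle_ineq4[of "z\<^sup>2" 1] power_le_one[of "norm z" 2] by (simp add: norm_power)
    then have "norm t * norm ((z\<^sup>2 - 1) / 2) \<le> r / 2 * 1"
      using t r by (intro mult_mono) (auto simp: norm_divide)
    moreover have "norm (z - of_real x) = r"
      using z by (simp add: dist_norm norm_minus_commute)
    moreover have "norm (q z) = norm t * norm ((z\<^sup>2 - 1) / 2) / norm (z - of_real x)"
      unfolding q_def norm_mult norm_divide ..
    ultimately show ?thesis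
      using r by (simp add: divide_le_eq)
  qed
  have ul: "uniform_limit (sphere (of_real x) r) (\<lambda>N z. \<Sum>n<N. f n z) (\<lambda>z. \<Sum>n. f n z) sequentially"
  proof (rule Weierstrass_m_test)
    show "norm (f n z) \<le> B / r * (1 / 2) ^ n" if z: "z \<in> sphere (of_real x) r" for n z
    proof -
      have r_eq: "norm (z - of_real x) = r"
        using z by (simp add: dist_norm norm_minus_commute)
      show ?thesis
        unfolding f_eq norm_mult norm_divide norm_power r_eq
        using B[OF z] q[OF z] r order_trans[OF norm_ge_zero B[OF z]]
        by (intro mult_mono power_mono divide_right_mono) auto
    qed
    show "summable (\<lambda>n. B / r * (1 / 2) ^ n)"
      by (intro summable_mult summable_geometric) simp
  qed
  have suminf_eq: "(\<Sum>n. f n z) = H z / (z - of_real x - t * ((z\<^sup>2 - 1) / 2))"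
    if z: "z \<in> sphere (of_real x) r" for z
  proof -
    have nz: "z - of_real x \<noteq> 0" using z r by auto
    have "(\<lambda>n. H z / (z - of_real x) * q z ^ n) sums (H z / (z - of_real x) * (1 / (1 - q z)))"
      using q[OF z] by (intro sums_mult geometric_sums) auto
    moreover have "e * (1 - a / e) = e - a" if "e \<noteq> 0" for a e :: complex
      using that by (simp add: right_diff_distrib)
    then have "(z - of_real x) * (1 - q z) = z - of_real x - t * ((z\<^sup>2 - 1) / 2)"
      unfolding q_def using nz .
    ultimately show ?thesis
      unfolding f_eq[symmetric] by (simp add: sums_iff)
  qed
  have "(\<lambda>N. contour_integral (circlepath (of_real x) r) (\<lambda>z. \<Sum>n<N. f n z)) \<longlonglongrightarrow>
          contour_integral (circlepath (of_real x) r) (\<lambda>z. \<Sum>n. f n z)"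
    by (rule contour_integral_uniform_limit_circlepath(2)[OF _ ul])
       (use r in \<open>auto intro!: always_eventually contour_integrable_sum has_contour_integral_integrable[OF int]\<close>)
  moreover have "contour_integral (circlepath (of_real x) r) (\<lambda>z. \<Sum>n<N. f n z) =
      (\<Sum>n<N. 2 * of_real pi * \<i> * (H (of_real x) * of_real (inv_jacobi \<alpha> \<beta> n x)) * t ^ n)" for N
    by (intro contour_integral_unique has_contour_integral_sum int) auto
  moreover have "contour_integral (circlepath (of_real x) r) (\<lambda>z. \<Sum>n. f n z) =
      contour_integral (circlepath (of_real x) r) (\<lambda>z. H z / (z - of_real x - t * ((z\<^sup>2 - 1) / 2)))"
    by (intro contour_integral_cong) (use r in \<open>auto simp: suminf_eq\<close>)
  ultimately show ?thesis
    by (simp add: sums_def H_def)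
qed

section \<open>Evaluation of the contour integral\<close>

text \<open>The bound on the imaginary part keeps \<open>ln c + l\<close> in the range of the principal logarithm.\<close>
lemma powr_mult_exp:
  fixes l :: complex
  assumes "c > 0" "\<bar>Im l\<bar> < pi"
  shows "(of_real c * exp l) powr a = of_real c powr a * exp (a * l)"
proof -
  have "of_real c * exp l = exp (of_real (ln c) + l)"
    using assms by (simp add: exp_add exp_of_real)
  moreover have "Ln (exp (of_real (ln c) + l)) = of_real (ln c) + l"
    using assms by (intro Ln_exp) auto
  ultimately show ?thesis
    using assms by (simp add: powr_def Ln_of_real exp_add distrib_left)
qed

context omega_branches begin

text \<open>The contour integral is evaluated by residues. The denominator \<open>z - x - t (z\<^sup>2 - 1) / 2\<close> is quadratic in \<open>z\<close>; its
  root near \<open>x\<close> is \<open>z\<^sub>0 = (1 - R) / t\<close>, written as \<open>(2 x - t) / (1 + R)\<close> to include \<open>t = 0\<close>, and the factorisation is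
  \<open>(z - z\<^sub>0) (1 + R - t z) / 2\<close>. At \<open>z\<^sub>0\<close> the second factor equals \<open>R\<close>, which produces the denominator of \<open>\<omega>\<close>, and
  \<open>1 - z\<^sub>0 = 2 (1 - x) / (1 - t + R)\<close>, \<open>1 + z\<^sub>0 = 2 (1 + x) / (1 + t + R)\<close> turn the weight at \<open>z\<^sub>0\<close> into the two
  bracketed powers.\<close>
lemma inv_jacobi_generating_near_0:
  "eventually (\<lambda>t. (\<lambda>n. of_real (inv_jacobi \<alpha> \<beta> n x) * t ^ n) sums genfun \<alpha> \<beta> t) (nhds 0)"
proof -
  define r where "r = (1 - \<bar>x\<bar>) / 2"
  define H where "H = complex_weight (-\<alpha>) (-\<beta>)"
  define z0 where "z0 = (\<lambda>t. (2 * of_real x - t) / (1 + R t))"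
  have r: "r > 0" "r < 1" using x by (auto simp: r_def)
  have sub: "cball (complex_of_real x) r \<subseteq> ball 0 1"
  proof
    fix z assume "z \<in> cball (complex_of_real x) r"
    then have "norm (z - of_real x) \<le> r" by (simp add: dist_norm norm_minus_commute)
    then have "norm z \<le> r + \<bar>x\<bar>"
      using norm_triangle_ineq[of "z - of_real x" "of_real x"] by simp
    also have "\<dots> < 1" using r x by (auto simp: r_def field_simps abs_if)
    finally show "z \<in> ball 0 1" by simp
  qed
  have isCont_0: "isCont f 0" if "f holomorphic_on ball 0 1" for f :: "complex \<Rightarrow> complex"
    using holomorphic_on_imp_continuous_on[OF that] continuous_on_eq_continuous_at[of "ball 0 1" f] by simp
  note cont = isCont_0[OF R_holo] isCont_0[OF L1_holo] isCont_0[OF L2_holo]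
  have lim: "(f \<longlongrightarrow> f 0) (nhds 0)" if "isCont f 0" for f :: "complex \<Rightarrow> 'a :: real_normed_vector"
    using that by (simp add: isCont_def tendsto_nhds_iff)
  \<comment> \<open>Smallness of \<open>t\<close> serves to keep the root \<open>z0\<close> inside the circle and the other root outside the unit disc,
    and to make the logarithms \<open>L1\<close>, \<open>L2\<close> compatible with the principal branch in the weight.\<close>
  have "isCont z0 0"
    unfolding z0_def using cont by (intro continuous_intros) (auto simp: R_0)
  then have "eventually (\<lambda>t. z0 t \<in> ball (of_real x) r) (nhds 0)"
    by (intro topological_tendstoD[OF lim]) (use r in \<open>auto simp: z0_def R_0\<close>)
  moreover have "eventually (\<lambda>t. Re (R t) \<in> {0<..}) (nhds 0)"
    by (rule topological_tendstoD[OF tendsto_Re[OF lim[OF cont(1)]]]) (auto simp: R_0)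
  moreover have "eventually (\<lambda>t. Im (L1 t) \<in> {-pi<..<pi}) (nhds 0)"
    by (rule topological_tendstoD[OF tendsto_Im[OF lim[OF cont(2)]]]) (auto simp: L1_0)
  moreover have "eventually (\<lambda>t. Im (L2 t) \<in> {-pi<..<pi}) (nhds 0)"
    by (rule topological_tendstoD[OF tendsto_Im[OF lim[OF cont(3)]]]) (auto simp: L2_0)
  moreover have "eventually (\<lambda>t :: complex. t \<in> ball 0 (r / 2)) (nhds 0)"
    by (intro eventually_nhds_in_open) (use r in auto)
  ultimately show ?thesis
  proof eventually_elim
    case (elim t)
    have t: "t \<in> ball 0 1" "norm t \<le> r / 2" "norm t < 1" using elim r by auto
    have Re_1R: "Re (1 + R t) > 1" using elim by simp
    then have nz_1R: "1 + R t \<noteq> 0" by (metis less_asym zero_complex.sel(1) zero_less_one)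
    have z0: "(1 + R t) * z0 t = 2 * of_real x - t"
      using nz_1R by (simp add: z0_def)
    have "(1 + R t) * (t * z0 t) = t * ((1 + R t) * z0 t)"
      by (simp only: mult_ac)
    also have "\<dots> = (1 + R t) * (1 - R t)"
      unfolding z0 using R_sq[OF t(1)] by (simp add: algebra_simps power2_eq_square)
    finally have "(1 + R t) * (t * z0 t) = (1 + R t) * (1 - R t)" .
    then have tz0: "t * z0 t = 1 - R t"
      using nz_1R by simp
    have nz: "1 + R t - t * z \<noteq> 0" if "z \<in> ball 0 1" for z
    proof
      assume "1 + R t - t * z = 0"
      then have "norm (1 + R t) = norm t * norm z" by (simp flip: norm_mult)
      also have "\<dots> \<le> 1 * 1" using that t by (intro mult_mono) auto
      finally show False using Re_1R complex_Re_le_cmod[of "1 + R t"] by linarith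
    qed
    define g where "g = (\<lambda>z. H z * 2 / (1 + R t - t * z))"
    have "g holomorphic_on ball 0 1"
      unfolding g_def H_def using nz by (intro holomorphic_intros complex_weight_holo) auto
    then have "g holomorphic_on cball (of_real x) r"
      using sub by (rule holomorphic_on_subset)
    then have "((\<lambda>u. g u / (u - z0 t)) has_contour_integral (2 * of_real pi * \<i> * g (z0 t))) (circlepath (of_real x) r)"
      by (rule Cauchy_integral_circlepath_simple) (use elim in \<open>simp add: dist_norm norm_minus_commute\<close>)
    moreover have "g z / (z - z0 t) = H z / (z - of_real x - t * ((z\<^sup>2 - 1) / 2))" for z
    proof -
      have "(1 + R t - t * z) * (z - z0 t) = (1 + R t) * z - (1 + R t) * z0 t - t * z * z + (t * z0 t) * z"
        by (simp add: algebra_simps)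
      also have "\<dots> = 2 * (z - of_real x - t * ((z\<^sup>2 - 1) / 2))"
        unfolding z0 tz0 by (simp add: algebra_simps power2_eq_square diff_divide_distrib)
      finally have factors: "(1 + R t - t * z) * (z - z0 t) = 2 * (z - of_real x - t * ((z\<^sup>2 - 1) / 2))" .
      have "g z / (z - z0 t) = 2 * H z / ((1 + R t - t * z) * (z - z0 t))"
        by (simp add: g_def mult.commute)
      then show ?thesis
        unfolding factors by (subst (asm) mult_divide_mult_cancel_left) simp_all
    qed
    moreover have "g (z0 t) = H (of_real x) * genfun \<alpha> \<beta> t"
    proof -
      have "(1 + R t) * ((1 - z0 t) * (1 - t + R t)) = (1 + R t) * (2 * of_real (1 - x))"
      proof -
        have "(1 + R t) * ((1 - z0 t) * (1 - t + R t)) = ((1 + R t) - (1 + R t) * z0 t) * (1 - t + R t)"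
          by (simp add: algebra_simps)
        also have "\<dots> = (1 + R t) * (2 * of_real (1 - x))"
          unfolding z0 using R_sq[OF t(1)] by (simp add: algebra_simps power2_eq_square)
        finally show ?thesis .
      qed
      then have "(1 - z0 t) * exp (L1 t) = 2 * of_real (1 - x)"
        using nz_1R exp_L1[OF t(1)] by simp
      then have A: "1 - z0 t = of_real (1 - x) * exp (of_real (ln 2) - L1 t)"
        by (simp add: exp_diff exp_of_real field_simps)
      have "(1 + R t) * ((1 + z0 t) * (1 + t + R t)) = (1 + R t) * (2 * of_real (1 + x))"
      proof -
        have "(1 + R t) * ((1 + z0 t) * (1 + t + R t)) = ((1 + R t) + (1 + R t) * z0 t) * (1 + t + R t)"
          by (simp add: algebra_simps)
        also have "\<dots> = (1 + R t) * (2 * of_real (1 + x))"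
          unfolding z0 using R_sq[OF t(1)] by (simp add: algebra_simps power2_eq_square)
        finally show ?thesis .
      qed
      then have "(1 + z0 t) * exp (L2 t) = 2 * of_real (1 + x)"
        using nz_1R exp_L2[OF t(1)] by simp
      then have B: "1 + z0 t = of_real (1 + x) * exp (of_real (ln 2) - L2 t)"
        by (simp add: exp_diff exp_of_real field_simps)
      have "H (z0 t) = (of_real (1 - x) powr of_real (-\<alpha>) * exp (of_real (-\<alpha>) * (of_real (ln 2) - L1 t))) *
                       (of_real (1 + x) powr of_real (-\<beta>) * exp (of_real (-\<beta>) * (of_real (ln 2) - L2 t)))"
        unfolding H_def complex_weight_def A B
        using x elim by (subst (1 2) powr_mult_exp) auto
      also have "of_real (-\<alpha>) * (of_real (ln 2) - L1 t) = of_real \<alpha> * (L1 t - of_real (ln 2))"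
        by (simp add: algebra_simps)
      also have "of_real (-\<beta>) * (of_real (ln 2) - L2 t) = of_real \<beta> * (L2 t - of_real (ln 2))"
        by (simp add: algebra_simps)
      finally have "H (z0 t) = H (of_real x) * (R t * genfun \<alpha> \<beta> t)"
        using R_nonzero[OF t(1)] by (simp add: H_def complex_weight_def genfun_def)
      moreover have "1 + R t - t * z0 t = 2 * R t"
        unfolding tz0 by simp
      ultimately show ?thesis
        unfolding g_def using R_nonzero[OF t(1)] by (simp only:) simp
    qed
    ultimately have "contour_integral (circlepath (of_real x) r) (\<lambda>z. H z / (z - of_real x - t * ((z\<^sup>2 - 1) / 2)))
        = 2 * of_real pi * \<i> * (H (of_real x) * genfun \<alpha> \<beta> t)"
      by (simp add: contour_integral_unique)
    with inv_jacobi_sums_contour_integral[OF x r(1) sub t(2), of \<alpha> \<beta>]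
    have "(\<lambda>n. 2 * of_real pi * \<i> * (H (of_real x) * of_real (inv_jacobi \<alpha> \<beta> n x)) * t ^ n)
            sums (2 * of_real pi * \<i> * (H (of_real x) * genfun \<alpha> \<beta> t))"
      by (simp add: H_def)
    then have "(\<lambda>n. (2 * of_real pi * \<i> * H (of_real x)) * (of_real (inv_jacobi \<alpha> \<beta> n x) * t ^ n))
            sums ((2 * of_real pi * \<i> * H (of_real x)) * genfun \<alpha> \<beta> t)"
      by (simp only: mult.assoc)
    moreover have "2 * of_real pi * \<i> * H (of_real x) \<noteq> 0"
      using x by (auto simp: H_def complex_weight_of_real)
    ultimately show ?case
      by (subst (asm) sums_mult_iff)
  qed
qed

lemma genfun_has_fps_expansion:
  "genfun \<alpha> \<beta> has_fps_expansion Abs_fps (\<lambda>n. of_real (inv_jacobi \<alpha> \<beta> n x))"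
  using inv_jacobi_generating_near_0 by (intro has_fps_expansionI) simp

text \<open>The local expansion identifies the Taylor coefficients of \<open>\<omega>\<close>, and \<open>\<omega>\<close> is holomorphic in the whole unit disc, so
  its Taylor series converges there.\<close>
lemma inv_jacobi_sums_genfun:
  assumes "norm t < 1"
  shows "(\<lambda>n. of_real (inv_jacobi \<alpha> \<beta> n x) * t ^ n) sums genfun \<alpha> \<beta> t"
  using holomorphic_power_series[OF genfun_holo, of t \<alpha> \<beta>] fps_nth_fps_expansion[OF genfun_has_fps_expansion, of \<alpha> \<beta>] assms
  by simp

end

section \<open>The recurrence relation\<close>

context omega_branches begin

lemma R_deriv:
  assumes t: "t \<in> ball 0 1"
  shows "R t * deriv R t = t - of_real x"
proof -
  have dR: "(R has_field_derivative deriv R t) (at t)"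
    using t R_holo by (auto intro!: holomorphic_derivI)
  have "((\<lambda>u. (R u)\<^sup>2) has_field_derivative 2 * R t * deriv R t) (at t)"
    by (rule derivative_eq_intros dR refl | simp)+
  moreover have "((\<lambda>u. (R u)\<^sup>2) has_field_derivative 2 * t - 2 * of_real x) (at t)"
  proof (rule has_field_derivative_transform_within_open[where S = "ball 0 1"])
    show "((\<lambda>u. 1 - 2 * of_real x * u + u\<^sup>2) has_field_derivative 2 * t - 2 * of_real x) (at t)"
      by (rule derivative_eq_intros refl | simp)+
  qed (use t R_sq in auto)
  ultimately have "2 * R t * deriv R t = 2 * t - 2 * of_real x"
    by (rule DERIV_unique)
  then have "2 * (R t * deriv R t) = 2 * (t - of_real x)" by (simp add: algebra_simps)
  then show ?thesis by (subst (asm) mult_cancel_left) simp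
qed

lemma log_deriv:
  assumes t: "t \<in> ball 0 1" and L: "L holomorphic_on ball 0 1"
      and exp_L: "\<And>u. u \<in> ball 0 1 \<Longrightarrow> exp (L u) = 1 + c * u + R u"
  shows "(1 + c * t + R t) * deriv L t = deriv R t + c"
proof -
  have dR: "(R has_field_derivative deriv R t) (at t)"
    and dL: "(L has_field_derivative deriv L t) (at t)"
    using t R_holo L by (auto intro!: holomorphic_derivI)
  have "((\<lambda>u. exp (L u)) has_field_derivative exp (L t) * deriv L t) (at t)"
    by (rule derivative_eq_intros dL refl)+
  moreover have "((\<lambda>u. exp (L u)) has_field_derivative deriv R t + c) (at t)"
  proof (rule has_field_derivative_transform_within_open[where S = "ball 0 1"])
    show "((\<lambda>u. 1 + c * u + R u) has_field_derivative deriv R t + c) (at t)"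
      by (rule derivative_eq_intros dR refl | simp)+
  qed (use t exp_L in auto)
  ultimately have "exp (L t) * deriv L t = deriv R t + c"
    by (rule DERIV_unique)
  then show ?thesis by (simp only: exp_L[OF t])
qed

text \<open>The logarithmic derivatives become simple because \<open>R R' = t - x\<close> and
  \<open>R\<^sup>2 = 1 - 2 x t + t\<^sup>2\<close>. The proof avoids the division by comparing both sides after
  multiplication with the non-zero bracket.\<close>
lemma log_deriv_explicit:
  assumes t: "t \<in> ball 0 1" and L: "L holomorphic_on ball 0 1" and c: "c = 1 \<or> c = -1"
      and exp_L: "\<And>u. u \<in> ball 0 1 \<Longrightarrow> exp (L u) = 1 + c * u + R u"
  shows "2 * R t * (t * deriv L t) = R t - 1 + c * t"
proof -
  have nz: "1 + c * t + R t \<noteq> 0"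
    unfolding exp_L[OF t, symmetric] by simp
  have "(1 + c * t + R t) * (2 * R t * (t * deriv L t)) = 2 * t * (R t * ((1 + c * t + R t) * deriv L t))"
    by (simp only: mult_ac)
  also have "\<dots> = 2 * t * (R t * deriv R t + c * R t)"
    by (subst log_deriv[OF t L, where c = c]) (simp_all add: exp_L algebra_simps)
  also have "\<dots> = 2 * t * (t - of_real x + c * R t)"
    by (simp only: R_deriv[OF t])
  also have "\<dots> = (1 + c * t + R t) * (R t - 1 + c * t)"
    using R_sq[OF t] c by (auto simp: algebra_simps power2_eq_square)
  finally show ?thesis
    using nz by simp
qed

text \<open>A first-order linear system in \<open>t\<close> for the generating function \<open>\<omega>\<close> and \<open>R \<omega>\<close>. The logarithmic
  derivative of \<open>\<omega>\<close> involves \<open>R\<close>; keeping \<open>R \<omega>\<close> as a second unknown makes all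
  coefficients polynomials in \<open>t\<close>, so that power series coefficients can be compared.\<close>
lemma
  fixes \<alpha> \<beta> :: real
  defines "s \<equiv> of_real ((\<alpha> + \<beta>) / 2)" and "d \<equiv> of_real ((\<alpha> - \<beta>) / 2)"
  assumes t: "t \<in> ball 0 1"
  shows genfun_system_1: "t * deriv (\<lambda>t. R t * genfun \<alpha> \<beta> t) t =
           s * (R t * genfun \<alpha> \<beta> t) - (s + d * t) * genfun \<alpha> \<beta> t"
    and genfun_system_2: "t * deriv (\<lambda>t. (1 - 2 * of_real x * t + t\<^sup>2) * genfun \<alpha> \<beta> t) t =
           t * (t - of_real x) * genfun \<alpha> \<beta> t + s * ((1 - 2 * of_real x * t + t\<^sup>2) * genfun \<alpha> \<beta> t)
           - (s + d * t) * (R t * genfun \<alpha> \<beta> t)"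
proof -
  define S where "S = (\<lambda>t. exp (of_real \<alpha> * (L1 t - of_real (ln 2))) * exp (of_real \<beta> * (L2 t - of_real (ln 2))))"
  define S' where "S' = S t * (of_real \<alpha> * deriv L1 t + of_real \<beta> * deriv L2 t)"
  define G where "G = genfun \<alpha> \<beta> t"
  have near: "eventually (\<lambda>t. t \<in> ball 0 1) (nhds t)"
    using t by (intro eventually_nhds_in_open) auto
  have S: "S u = R u * genfun \<alpha> \<beta> u" if "u \<in> ball 0 1" for u
    using R_nonzero[OF that] by (simp add: genfun_def S_def)
  have dR: "(R has_field_derivative deriv R t) (at t)"
    and dL1: "(L1 has_field_derivative deriv L1 t) (at t)"
    and dL2: "(L2 has_field_derivative deriv L2 t) (at t)"
    using t R_holo L1_holo L2_holo by (auto intro!: holomorphic_derivI)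
  have tL1: "2 * R t * (t * deriv L1 t) = R t - 1 - t"
    using log_deriv_explicit[OF t L1_holo, of "-1"] exp_L1 by simp
  have tL2: "2 * R t * (t * deriv L2 t) = R t - 1 + t"
    using log_deriv_explicit[OF t L2_holo, of 1] exp_L2 by simp
  have sd: "of_real \<alpha> = s + d" "of_real \<beta> = s - d"
    by (simp_all add: s_def d_def field_simps)
  have "((\<lambda>u. exp (of_real \<alpha> * (L1 u - of_real (ln 2)))) has_field_derivative
          exp (of_real \<alpha> * (L1 t - of_real (ln 2))) * (of_real \<alpha> * deriv L1 t)) (at t)"
    by (rule derivative_eq_intros dL1 refl | simp)+
  moreover have "((\<lambda>u. exp (of_real \<beta> * (L2 u - of_real (ln 2)))) has_field_derivative
          exp (of_real \<beta> * (L2 t - of_real (ln 2))) * (of_real \<beta> * deriv L2 t)) (at t)"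
    by (rule derivative_eq_intros dL2 refl | simp)+
  ultimately have dS: "(S has_field_derivative S') (at t)"
    using DERIV_mult unfolding S_def S'_def by (fastforce simp: algebra_simps)
  have "2 * (t * S') = G * (of_real \<alpha> * (2 * R t * (t * deriv L1 t)) + of_real \<beta> * (2 * R t * (t * deriv L2 t)))"
    unfolding S'_def S[OF t] G_def by (simp add: algebra_simps)
  also have "\<dots> = 2 * (s * (R t * G) - (s + d * t) * G)"
    unfolding tL1 tL2 sd by (simp add: algebra_simps)
  finally have tS': "t * S' = s * (R t * G) - (s + d * t) * G"
    by (subst (asm) mult_cancel_left) simp
  have "deriv (\<lambda>t. R t * genfun \<alpha> \<beta> t) t = deriv S t"
    by (rule deriv_cong_ev) (use near S in \<open>auto elim!: eventually_mono\<close>)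
  then show "t * deriv (\<lambda>t. R t * genfun \<alpha> \<beta> t) t =
           s * (R t * genfun \<alpha> \<beta> t) - (s + d * t) * genfun \<alpha> \<beta> t"
    using tS' DERIV_imp_deriv[OF dS] by (simp add: G_def)
  have "(1 - 2 * of_real x * u + u\<^sup>2) * genfun \<alpha> \<beta> u = R u * S u" if "u \<in> ball 0 1" for u
    unfolding R_sq[OF that, symmetric] S[OF that] by (simp add: power2_eq_square)
  then have "deriv (\<lambda>t. (1 - 2 * of_real x * t + t\<^sup>2) * genfun \<alpha> \<beta> t) t = deriv (\<lambda>t. R t * S t) t"
    by (intro deriv_cong_ev eventually_mono[OF near]) auto
  also have "\<dots> = deriv R t * S t + S' * R t"
    by (intro DERIV_imp_deriv DERIV_mult dR dS)
  finally have "t * deriv (\<lambda>t. (1 - 2 * of_real x * t + t\<^sup>2) * genfun \<alpha> \<beta> t) t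
     = t * (R t * deriv R t) * G + R t * (t * S')"
    by (simp add: algebra_simps S[OF t] G_def)
  also have "\<dots> = t * (t - of_real x) * G + s * ((R t)\<^sup>2 * G) - (s + d * t) * (R t * G)"
    unfolding tS' R_deriv[OF t] by (simp add: algebra_simps power2_eq_square)
  finally show "t * deriv (\<lambda>t. (1 - 2 * of_real x * t + t\<^sup>2) * genfun \<alpha> \<beta> t) t =
           t * (t - of_real x) * genfun \<alpha> \<beta> t + s * ((1 - 2 * of_real x * t + t\<^sup>2) * genfun \<alpha> \<beta> t)
           - (s + d * t) * (R t * genfun \<alpha> \<beta> t)"
    unfolding R_sq[OF t] G_def .
qed

text \<open>Comparing coefficients in the first-order system gives, with \<open>p\<^sub>n\<close> and \<open>s\<^sub>n\<close> the coefficients of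
  \<open>\<omega>\<close> and \<open>R \<omega>\<close>, a relation that expresses \<open>(n - (\<alpha> + \<beta>) / 2) s\<^sub>n\<close> through \<open>p\<^sub>n\<close>, \<open>p\<^bsub>n - 1\<^esub>\<close>, and one that
  contains \<open>s\<^sub>n\<close> and \<open>s\<^bsub>n - 1\<^esub>\<close>. Multiplying the latter by the factors of both \<open>s\<^sub>n\<close> and \<open>s\<^bsub>n - 1\<^esub>\<close> eliminates them without
  any division, so the recurrence holds also where these factors vanish. It is
  stated with \<open>n = m + 1\<close>, so that all indices are natural numbers.\<close>
lemma inv_jacobi_recurrence:
  fixes \<alpha> \<beta> :: real and m :: nat
  defines "P \<equiv> \<lambda>n. inv_jacobi \<alpha> \<beta> n x"
  shows "2 * (real m + 2) * (real m + 2 - \<alpha> - \<beta>) * (2 * real m + 2 - \<alpha> - \<beta>) * P (Suc (Suc m))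
       - (2 * real m + 3 - \<alpha> - \<beta>)
           * ((2 * real m + 4 - \<alpha> - \<beta>) * (2 * real m + 2 - \<alpha> - \<beta>) * x + \<alpha>\<^sup>2 - \<beta>\<^sup>2) * P (Suc m)
       + 2 * (real m + 1 - \<alpha>) * (real m + 1 - \<beta>) * (2 * real m + 4 - \<alpha> - \<beta>) * P m = 0"
proof -
  define s d where "s = complex_of_real ((\<alpha> + \<beta>) / 2)" and "d = complex_of_real ((\<alpha> - \<beta>) / 2)"
  define F where "F = Abs_fps (\<lambda>n. complex_of_real (P n))"
  define S where "S = fps_expansion (\<lambda>t. R t * genfun \<alpha> \<beta> t) 0"
  define Q :: "complex fps" where "Q = 1 - fps_const (2 * of_real x) * fps_X + fps_X ^ 2"
  \<comment> \<open>A name for the product prevents the simplifier from applying the product rule to its derivative.\<close>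
  define G where "G = Q * F"
  have near: "eventually (\<lambda>t :: complex. t \<in> ball 0 1) (nhds 0)"
    by (intro eventually_nhds_in_open) auto
  have F: "genfun \<alpha> \<beta> has_fps_expansion F"
    unfolding F_def P_def by (rule genfun_has_fps_expansion)
  have S: "(\<lambda>t. R t * genfun \<alpha> \<beta> t) has_fps_expansion S"
    unfolding S_def
    by (rule has_fps_expansion_fps_expansion[of "ball 0 1"]) (auto intro!: holomorphic_intros R_holo genfun_holo)
  have QF: "(\<lambda>t. (1 - 2 * of_real x * t + t\<^sup>2) * genfun \<alpha> \<beta> t) has_fps_expansion Q * F"
    unfolding Q_def by (intro fps_expansion_intros F)
  have "fps_X * fps_deriv S = fps_const s * S - (fps_const s + fps_const d * fps_X) * F"
  proof (rule fps_expansion_unique_complex)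
    show "(\<lambda>t. t * deriv (\<lambda>t. R t * genfun \<alpha> \<beta> t) t) has_fps_expansion fps_X * fps_deriv S"
      by (intro fps_expansion_intros S)
    have "(\<lambda>t. s * (R t * genfun \<alpha> \<beta> t) - (s + d * t) * genfun \<alpha> \<beta> t) has_fps_expansion
            fps_const s * S - (fps_const s + fps_const d * fps_X) * F"
      by (intro fps_expansion_intros S F)
    moreover have "eventually (\<lambda>t. s * (R t * genfun \<alpha> \<beta> t) - (s + d * t) * genfun \<alpha> \<beta> t =
        t * deriv (\<lambda>t. R t * genfun \<alpha> \<beta> t) t) (nhds 0)"
      using near by eventually_elim (simp only: genfun_system_1 s_def d_def)
    ultimately show "(\<lambda>t. t * deriv (\<lambda>t. R t * genfun \<alpha> \<beta> t) t) has_fps_expansion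
         fps_const s * S - (fps_const s + fps_const d * fps_X) * F"
      by (rule has_fps_expansion_cong[THEN iffD1, OF _ refl, rotated])
  qed
  then have S_coeff: "of_nat (Suc n) * fps_nth S (Suc n) = s * fps_nth S (Suc n) - s * fps_nth F (Suc n) - d * fps_nth F n" for n
    by (auto dest!: arg_cong[of _ _ "\<lambda>f. fps_nth f (Suc n)"] simp: distrib_right mult.assoc)
  have "fps_X * fps_deriv (Q * F) = fps_X * (fps_X - fps_const (of_real x)) * F + fps_const s * (Q * F)
          - (fps_const s + fps_const d * fps_X) * S"
  proof (rule fps_expansion_unique_complex)
    show "(\<lambda>t. t * deriv (\<lambda>t. (1 - 2 * of_real x * t + t\<^sup>2) * genfun \<alpha> \<beta> t) t) has_fps_expansion fps_X * fps_deriv (Q * F)"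
      by (intro fps_expansion_intros QF)
    have "(\<lambda>t. t * (t - of_real x) * genfun \<alpha> \<beta> t + s * ((1 - 2 * of_real x * t + t\<^sup>2) * genfun \<alpha> \<beta> t)
           - (s + d * t) * (R t * genfun \<alpha> \<beta> t)) has_fps_expansion
            fps_X * (fps_X - fps_const (of_real x)) * F + fps_const s * (Q * F)
          - (fps_const s + fps_const d * fps_X) * S"
      by (intro fps_expansion_intros S F QF)
    moreover have "eventually (\<lambda>t. t * (t - of_real x) * genfun \<alpha> \<beta> t + s * ((1 - 2 * of_real x * t + t\<^sup>2) * genfun \<alpha> \<beta> t)
           - (s + d * t) * (R t * genfun \<alpha> \<beta> t) =
        t * deriv (\<lambda>t. (1 - 2 * of_real x * t + t\<^sup>2) * genfun \<alpha> \<beta> t) t) (nhds 0)"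
      using near by eventually_elim (simp only: genfun_system_2 s_def d_def)
    ultimately show "(\<lambda>t. t * deriv (\<lambda>t. (1 - 2 * of_real x * t + t\<^sup>2) * genfun \<alpha> \<beta> t) t) has_fps_expansion
        fps_X * (fps_X - fps_const (of_real x)) * F + fps_const s * (Q * F)
          - (fps_const s + fps_const d * fps_X) * S"
      by (rule has_fps_expansion_cong[THEN iffD1, OF _ refl, rotated])
  qed
  from arg_cong[OF this, of "\<lambda>f. fps_nth f (Suc (Suc m))"]
  have QF_coeff: "of_nat (Suc (Suc m)) * fps_nth (Q * F) (Suc (Suc m)) =
      fps_nth F m - of_real x * fps_nth F (Suc m) + s * fps_nth (Q * F) (Suc (Suc m))
      - s * fps_nth S (Suc (Suc m)) - d * fps_nth S (Suc m)"
    unfolding G_def[symmetric] by (simp add: distrib_right left_diff_distrib mult.assoc)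
  have Q_nth: "fps_nth (Q * F) (Suc (Suc m)) = fps_nth F (Suc (Suc m)) - 2 * of_real x * fps_nth F (Suc m) + fps_nth F m"
    by (simp add: Q_def distrib_right left_diff_distrib mult.assoc power2_eq_square)
  define p0 p1 p2 s1 s2 M where "p0 = fps_nth F m" and "p1 = fps_nth F (Suc m)" and "p2 = fps_nth F (Suc (Suc m))"
    and "s1 = fps_nth S (Suc m)" and "s2 = fps_nth S (Suc (Suc m))" and "M = complex_of_nat m"
  have s1: "(M + 1 - s) * s1 = - s * p1 - d * p0"
    using S_coeff[of m] by (simp add: p0_def p1_def s1_def M_def algebra_simps)
  have s2: "(M + 2 - s) * s2 = - s * p2 - d * p1"
    using S_coeff[of "Suc m"] by (simp add: p2_def p1_def s2_def M_def algebra_simps)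
  have rel: "(M + 2 - s) * (p2 - 2 * of_real x * p1 + p0) - p0 + of_real x * p1 + s * s2 + d * s1 = 0"
    using QF_coeff unfolding Q_nth
    by (simp add: p0_def p1_def p2_def s1_def s2_def M_def algebra_simps)
  have "(M + 1 - s) * (M + 2 - s) * ((M + 2 - s) * (p2 - 2 * of_real x * p1 + p0) - p0 + of_real x * p1)
          + s * (M + 1 - s) * ((M + 2 - s) * s2) + d * (M + 2 - s) * ((M + 1 - s) * s1)
      = (M + 1 - s) * (M + 2 - s) * ((M + 2 - s) * (p2 - 2 * of_real x * p1 + p0) - p0 + of_real x * p1 + s * s2 + d * s1)"
    by (simp add: algebra_simps)
  then have *: "(M + 1 - s) * (M + 2 - s) * ((M + 2 - s) * (p2 - 2 * of_real x * p1 + p0) - p0 + of_real x * p1)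
          + s * (M + 1 - s) * (- s * p2 - d * p1) + d * (M + 2 - s) * (- s * p1 - d * p0) = 0"
    unfolding s1 s2 rel by simp
  have sd: "s + d = of_real \<alpha>" "s - d = of_real \<beta>"
    by (simp_all add: s_def d_def field_simps)
  have P: "complex_of_real (P m) = p0" "complex_of_real (P (Suc m)) = p1" "complex_of_real (P (Suc (Suc m))) = p2"
    by (simp_all add: p0_def p1_def p2_def F_def)
  have "complex_of_real (2 * (real m + 2) * (real m + 2 - \<alpha> - \<beta>) * (2 * real m + 2 - \<alpha> - \<beta>) * P (Suc (Suc m))
       - (2 * real m + 3 - \<alpha> - \<beta>)
           * ((2 * real m + 4 - \<alpha> - \<beta>) * (2 * real m + 2 - \<alpha> - \<beta>) * x + \<alpha>\<^sup>2 - \<beta>\<^sup>2) * P (Suc m)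
       + 2 * (real m + 1 - \<alpha>) * (real m + 1 - \<beta>) * (2 * real m + 4 - \<alpha> - \<beta>) * P m) =
      2 * (M + 2) * (M + 2 - (s + d) - (s - d)) * (2 * M + 2 - (s + d) - (s - d)) * p2
       - (2 * M + 3 - (s + d) - (s - d))
           * ((2 * M + 4 - (s + d) - (s - d)) * (2 * M + 2 - (s + d) - (s - d)) * of_real x + (s + d)\<^sup>2 - (s - d)\<^sup>2) * p1
       + 2 * (M + 1 - (s + d)) * (M + 1 - (s - d)) * (2 * M + 4 - (s + d) - (s - d)) * p0"
    unfolding sd P[symmetric] M_def by simp
  \<comment> \<open>Since \<open>2 s = \<alpha> + \<beta>\<close>, each of the two multipliers contributes a factor \<open>2\<close>.\<close>
  also have "\<dots> = 4 * ((M + 1 - s) * (M + 2 - s) * ((M + 2 - s) * (p2 - 2 * of_real x * p1 + p0) - p0 + of_real x * p1)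
          + s * (M + 1 - s) * (- s * p2 - d * p1) + d * (M + 2 - s) * (- s * p1 - d * p0))"
    by (simp add: algebra_simps power2_eq_square)
  also have "\<dots> = 0"
    unfolding * by simp
  finally show ?thesis
    unfolding of_real_eq_0_iff .
qed

end

section \<open>Self-adjointness\<close>

lemma test_function_derivs:
  assumes "test_function I f"
  shows "((deriv ^^ n) f has_real_derivative (deriv ^^ Suc n) f x) (at x)"
  using assms by (auto simp: test_function_def differentiable_on_def real_differentiable_def
      intro!: DERIV_deriv_iff_real_differentiable[THEN iffD2])

text \<open>The largest absolute value on the union of the two compact supports is some \<open>m < 1\<close>, and the midpoint
  between \<open>m\<close> and \<open>1\<close> leaves room to have zeros already at the endpoints.\<close>
lemma test_functions_common_support:
  assumes "test_function {-1<..<1} f" "test_function {-1<..<1} g"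
  obtains c where "0 < c" "c < 1" "\<And>x. c \<le> \<bar>x\<bar> \<Longrightarrow> f x = 0 \<and> g x = 0"
proof -
  define K where "K = closure {x. f x \<noteq> 0} \<union> closure {x. g x \<noteq> 0}"
  have K: "compact K" "K \<subseteq> {-1<..<1}"
    using assms by (auto simp: K_def test_function_def)
  have "compact (insert 0 (abs ` K))"
    using K by (intro compact_insert compact_continuous_image continuous_intros) auto
  then obtain m where m: "m \<in> insert 0 (abs ` K)" "\<And>y. y \<in> insert 0 (abs ` K) \<Longrightarrow> y \<le> m"
    using compact_attains_sup[of "insert 0 (abs ` K)"] by blast
  have "0 \<le> m" "m < 1" using m K(2) by (auto simp: abs_less_iff)
  show thesis
  proof
    show "0 < (m + 1) / 2" "(m + 1) / 2 < 1" using \<open>0 \<le> m\<close> \<open>m < 1\<close> by auto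
    fix x assume "(m + 1) / 2 \<le> \<bar>x\<bar>"
    then have "x \<notin> K" using m(2)[of "\<bar>x\<bar>"] \<open>m < 1\<close> by force
    then show "f x = 0 \<and> g x = 0"
      using closure_subset[of "{x. f x \<noteq> 0}"] closure_subset[of "{x. g x \<noteq> 0}"] by (auto simp: K_def)
  qed
qed

text \<open>The Sturm--Liouville form of the operator, which is the reason for its symmetry: the weight times the operator is
  the derivative of \<open>(1 - x\<^sup>2)\<close> times the weight times \<open>f'\<close>.\<close>
lemma inv_jacobi_op_divergence_form:
  assumes x: "x \<in> {-1<..<1}" and f: "(deriv f has_real_derivative deriv (deriv f) x) (at x)"
  shows "((\<lambda>x. (1 - x) powr (1 - \<alpha>) * (1 + x) powr (1 - \<beta>) * deriv f x) has_real_derivative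
           (1 - x) powr (- \<alpha>) * (1 + x) powr (- \<beta>) * inv_jacobi_op \<alpha> \<beta> f x) (at x)"
proof -
  have pos: "1 - x > 0" "1 + x > 0" using x by auto
  have *: "(1 - x) powr (1 - \<alpha>) = (1 - x) powr (- \<alpha>) * (1 - x)" "(1 + x) powr (1 - \<beta>) = (1 + x) powr (- \<beta>) * (1 + x)"
    using pos by (simp_all add: powr_diff powr_minus divide_inverse)
  have **: "1 - \<alpha> - 1 = - \<alpha>" "1 - \<beta> - 1 = - \<beta>" by auto
  have d1: "((\<lambda>x. (1 - x) powr (1 - \<alpha>)) has_real_derivative - (1 - \<alpha>) * (1 - x) powr (- \<alpha>)) (at x)"
    by (rule derivative_eq_intros refl pos | simp only: **)+ (simp add: algebra_simps)
  have d2: "((\<lambda>x. (1 + x) powr (1 - \<beta>)) has_real_derivative (1 - \<beta>) * (1 + x) powr (- \<beta>)) (at x)"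
    by (rule derivative_eq_intros refl pos | simp only: **)+ (simp add: algebra_simps)
  show ?thesis
    by (rule DERIV_cong[OF DERIV_mult[OF DERIV_mult[OF d1 d2] f]])
       (simp only: * inv_jacobi_op_def, simp add: algebra_simps power2_eq_square del: powr_minus)
qed

text \<open>By the divergence form, the difference of the two integrands is the derivative of
  \<open>p (f' g - f g')\<close> with \<open>p = (1 - x)\<^bsup>1 - \<alpha>\<^esup> (1 + x)\<^bsup>1 - \<beta>\<^esup>\<close>. Near the endpoints \<open>\<plusminus>1\<close> the weight may be unbounded, so
  everything is first moved to a compact interval \<open>[-c, c]\<close> outside of which both functions vanish; there the integrands
  are continuous.\<close>
lemma inv_jacobi_op_self_adjoint:
  "formally_self_adjoint (inv_jacobi_op \<alpha> \<beta>) {-1<..<1} (jacobi_measure (- \<alpha>) (- \<beta>))"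
  unfolding formally_self_adjoint_def
proof (intro allI impI)
  fix f g assume fg: "test_function {-1<..<1} f" "test_function {-1<..<1} g"
  obtain c where c: "0 < c" "c < 1" "\<And>x. c \<le> \<bar>x\<bar> \<Longrightarrow> f x = 0 \<and> g x = 0"
    by (rule test_functions_common_support[OF fg]) blast
  define w where "w = (\<lambda>x::real. (1 - x) powr (- \<alpha>) * (1 + x) powr (- \<beta>))"
  define p where "p = (\<lambda>x::real. (1 - x) powr (1 - \<alpha>) * (1 + x) powr (1 - \<beta>))"
  define T where "T = inv_jacobi_op \<alpha> \<beta>"
  have f0: "(f has_real_derivative deriv f x) (at x)" and f1: "(deriv f has_real_derivative deriv (deriv f) x) (at x)"
    and f2: "isCont (deriv (deriv f)) x" for x
    using test_function_derivs[OF fg(1), of 0 x] test_function_derivs[OF fg(1), of 1 x]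
      DERIV_isCont[OF test_function_derivs[OF fg(1), of 2 x]] by (simp_all add: numeral_2_eq_2)
  have g0: "(g has_real_derivative deriv g x) (at x)" and g1: "(deriv g has_real_derivative deriv (deriv g) x) (at x)"
    and g2: "isCont (deriv (deriv g)) x" for x
    using test_function_derivs[OF fg(2), of 0 x] test_function_derivs[OF fg(2), of 1 x]
      DERIV_isCont[OF test_function_derivs[OF fg(2), of 2 x]] by (simp_all add: numeral_2_eq_2)
  have I: "x \<in> {-1<..<1}" if "-c \<le> x" "x \<le> c" for x using that c by auto
  have cont_w: "isCont w x" if "-c \<le> x" "x \<le> c" for x
    unfolding w_def using I[OF that] by (intro continuous_intros) auto
  have cont_T: "isCont (T h) x" if "isCont (deriv (deriv h)) x" "isCont (deriv h) x" for h x
    unfolding T_def inv_jacobi_op_def by (intro continuous_intros that)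
  have cont_f: "isCont (\<lambda>x. w x * (T f x * g x)) x" and cont_g: "isCont (\<lambda>x. w x * (f x * T g x)) x"
    if "-c \<le> x" "x \<le> c" for x
    by (intro continuous_intros cont_w cont_T that f2 g2 DERIV_isCont[OF f1] DERIV_isCont[OF g1]
          DERIV_isCont[OF f0] DERIV_isCont[OF g0])+
  have transfer: "set_integrable (jacobi_measure (- \<alpha>) (- \<beta>)) {-1<..<1} h \<and>
      (LINT x:{-1<..<1}|jacobi_measure (- \<alpha>) (- \<beta>). h x) = (LINT x:{-c..c}|lborel. w x * h x)"
    if cont: "\<And>x. -c \<le> x \<Longrightarrow> x \<le> c \<Longrightarrow> isCont (\<lambda>x. w x * h x) x" and zero: "\<And>x. c \<le> \<bar>x\<bar> \<Longrightarrow> h x = 0"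
      and meas: "h \<in> borel_measurable borel" for h
  proof -
    have int: "set_integrable lborel {-c..c} (\<lambda>x. w x * h x)"
      using cont by (intro borel_integrable_atLeastAtMost') (auto intro!: continuous_at_imp_continuous_on)
    have eq: "indicator {-1<..<1} x * w x * (indicator {-1<..<1} x *\<^sub>R h x) = indicator {-c..c} x *\<^sub>R (w x * h x)" for x
    proof (cases "c \<le> \<bar>x\<bar>")
      case True
      then show ?thesis using zero[of x] by simp
    next
      case False
      then have "x \<in> {-c..c}" "x \<in> {-1<..<1}" using c(2) by auto
      then show ?thesis by simp
    qed
    have nn: "AE x in lborel. 0 \<le> indicator {-1<..<1} x * w x"
      by (auto simp: w_def)
    have wm: "w \<in> borel_measurable borel" unfolding w_def by measurable
    have M: "jacobi_measure (- \<alpha>) (- \<beta>) = density lborel (\<lambda>x. ennreal (indicator {-1<..<1} x * w x))"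
      by (simp add: jacobi_measure_def w_def)
    have dm: "(\<lambda>x. indicator {-1<..<1} x * w x) \<in> borel_measurable lborel"
      and hm: "(\<lambda>x. indicator {-1<..<1} x *\<^sub>R h x) \<in> borel_measurable lborel"
      using meas wm by measurable
    show ?thesis
      using int unfolding M set_integrable_def set_lebesgue_integral_def
        integrable_density[OF hm dm nn] integral_density[OF hm dm nn]
      unfolding real_scaleR_def eq[unfolded real_scaleR_def] by simp
  qed
  have cont: "isCont f x" "isCont g x" "isCont (T f) x" "isCont (T g) x" for x
    by (intro cont_T f2 g2 DERIV_isCont[OF f0] DERIV_isCont[OF g0] DERIV_isCont[OF f1] DERIV_isCont[OF g1])+
  have meas: "(\<lambda>x. T f x * g x) \<in> borel_measurable borel" "(\<lambda>x. f x * T g x) \<in> borel_measurable borel"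
    by (intro borel_measurable_continuous_onI continuous_at_imp_continuous_on ballI isCont_mult cont)+
  have Tf: "set_integrable (jacobi_measure (- \<alpha>) (- \<beta>)) {-1<..<1} (\<lambda>x. T f x * g x) \<and>
      (LINT x:{-1<..<1}|jacobi_measure (- \<alpha>) (- \<beta>). T f x * g x) = (LINT x:{-c..c}|lborel. w x * (T f x * g x))"
    by (rule transfer[OF cont_f _ meas(1)]) (use c(3) in auto)
  have Tg: "set_integrable (jacobi_measure (- \<alpha>) (- \<beta>)) {-1<..<1} (\<lambda>x. f x * T g x) \<and>
      (LINT x:{-1<..<1}|jacobi_measure (- \<alpha>) (- \<beta>). f x * T g x) = (LINT x:{-c..c}|lborel. w x * (f x * T g x))"
    by (rule transfer[OF cont_g _ meas(2)]) (use c(3) in auto)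
  have "has_bochner_integral lborel (\<lambda>x. (w x * (T f x * g x) - w x * (f x * T g x)) * indicator {-c..c} x)
          ((p c * deriv f c * g c - p c * deriv g c * f c) - (p (-c) * deriv f (-c) * g (-c) - p (-c) * deriv g (-c) * f (-c)))"
  proof (rule has_bochner_integral_FTC_Icc_real)
    fix x assume x: "-c \<le> x" "x \<le> c"
    show "isCont (\<lambda>x. w x * (T f x * g x) - w x * (f x * T g x)) x"
      by (intro continuous_intros cont_f cont_g x)
    have "((\<lambda>x. p x * deriv f x) has_real_derivative w x * T f x) (at x)"
      "((\<lambda>x. p x * deriv g x) has_real_derivative w x * T g x) (at x)"
      unfolding p_def w_def T_def by (intro inv_jacobi_op_divergence_form I x f1 g1)+
    from DERIV_diff[OF DERIV_mult[OF this(1) g0] DERIV_mult[OF this(2) f0]]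
    show "((\<lambda>x. p x * deriv f x * g x - p x * deriv g x * f x) has_real_derivative
            w x * (T f x * g x) - w x * (f x * T g x)) (at x)"
      by (rule DERIV_cong) (simp add: algebra_simps)
  qed (use c in auto)
  then have "(LINT x:{-c..c}|lborel. w x * (T f x * g x) - w x * (f x * T g x)) = 0"
    using c(3)[of c] c(3)[of "-c"] c(1)
    by (simp add: set_lebesgue_integral_def has_bochner_integral_iff mult.commute)
  moreover have "set_integrable lborel {-c..c} (\<lambda>x. w x * (T f x * g x))" "set_integrable lborel {-c..c} (\<lambda>x. w x * (f x * T g x))"
    using cont_f cont_g by (auto intro!: borel_integrable_atLeastAtMost' continuous_at_imp_continuous_on)
  ultimately have "(LINT x:{-c..c}|lborel. w x * (T f x * g x)) = (LINT x:{-c..c}|lborel. w x * (f x * T g x))"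
    by (simp add: set_integral_diff)
  with Tf Tg show "set_integrable (jacobi_measure (- \<alpha>) (- \<beta>)) {-1<..<1} (\<lambda>x. inv_jacobi_op \<alpha> \<beta> f x * g x) \<and>
       set_integrable (jacobi_measure (- \<alpha>) (- \<beta>)) {-1<..<1} (\<lambda>x. f x * inv_jacobi_op \<alpha> \<beta> g x) \<and>
       (LINT x:{-1<..<1}|jacobi_measure (- \<alpha>) (- \<beta>). inv_jacobi_op \<alpha> \<beta> f x * g x) =
       (LINT x:{-1<..<1}|jacobi_measure (- \<alpha>) (- \<beta>). f x * inv_jacobi_op \<alpha> \<beta> g x)"
    by (simp add: T_def)
qed

section \<open>Generating function, recurrence and differential equation of the family\<close>

theorem theorem1p3:
  fixes \<alpha> \<beta> :: real
  assumes "\<alpha> > -1" and "\<beta> > -1"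
  shows "(\<forall>n. \<exists>p :: real poly. \<forall>x\<in>{-1<..<1}. inv_jacobi \<alpha> \<beta> n x = poly p x) \<and>
    (\<forall>x\<in>{-1<..<1}. \<forall>t::complex. norm t < 1 \<longrightarrow>
       (\<lambda>n. of_real (inv_jacobi \<alpha> \<beta> n x) * t ^ n) sums omega \<alpha> \<beta> x t) \<and>
    (\<forall>n::nat. n \<ge> 1 \<longrightarrow> (\<forall>x\<in>{-1<..<1}.
         2 * (real n + 1) * (real n - \<alpha> - \<beta> + 1) * (2 * real n - \<alpha> - \<beta>)
           * inv_jacobi_ext \<alpha> \<beta> (int n + 1) x
       - (2 * real n - \<alpha> - \<beta> + 1)
           * ((2 * real n - \<alpha> - \<beta> + 2) * (2 * real n - \<alpha> - \<beta>) * x + \<alpha>\<^sup>2 - \<beta>\<^sup>2)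
           * inv_jacobi_ext \<alpha> \<beta> (int n) x
       + 2 * (real n - \<alpha>) * (real n - \<beta>) * (2 * real n - \<alpha> - \<beta> + 2)
           * inv_jacobi_ext \<alpha> \<beta> (int n - 1) x = 0)) \<and>
    (\<forall>x\<in>{-1<..<1}. inv_jacobi_ext \<alpha> \<beta> 0 x = 1 \<and> inv_jacobi_ext \<alpha> \<beta> (-1) x = 0) \<and>
    formally_self_adjoint (inv_jacobi_op \<alpha> \<beta>) {-1<..<1} (jacobi_measure (- \<alpha>) (- \<beta>)) \<and>
    (\<forall>n. \<forall>x\<in>{-1<..<1}.
       inv_jacobi_op \<alpha> \<beta> (inv_jacobi \<alpha> \<beta> n) x
         = - real n * (real n - \<alpha> - \<beta> + 1) * inv_jacobi \<alpha> \<beta> n x)"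
proof (intro conjI allI ballI impI)
  show "\<exists>p. \<forall>x\<in>{-1<..<1}. inv_jacobi \<alpha> \<beta> n x = poly p x" for n
    using inv_jacobi_eq_poly by blast
next
  fix x :: real and t :: complex
  assume x: "x \<in> {-1<..<1}" and t: "norm t < 1"
  obtain R L1 L2 where "omega_branches x R L1 L2"
    and omega: "omega \<alpha> \<beta> x t = omega_branches.genfun R L1 L2 \<alpha> \<beta> t"
    using omega_branches_exist[OF x] t by (metis mem_ball_0)
  then interpret omega_branches x R L1 L2 by simp
  show "(\<lambda>n. of_real (inv_jacobi \<alpha> \<beta> n x) * t ^ n) sums omega \<alpha> \<beta> x t"
    unfolding omega by (rule inv_jacobi_sums_genfun[OF t])
next
  fix n :: nat and x :: real
  assume n: "n \<ge> 1" and x: "x \<in> {-1<..<1}"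
  obtain m where m: "n = Suc m" using n by (cases n) auto
  obtain R L1 L2 where "omega_branches x R L1 L2"
    using omega_branches_exist[OF x] by metis
  then interpret omega_branches x R L1 L2 .
  have ext: "inv_jacobi_ext \<alpha> \<beta> (int n + 1) x = inv_jacobi \<alpha> \<beta> (Suc (Suc m)) x"
    "inv_jacobi_ext \<alpha> \<beta> (int n) x = inv_jacobi \<alpha> \<beta> (Suc m) x"
    "inv_jacobi_ext \<alpha> \<beta> (int n - 1) x = inv_jacobi \<alpha> \<beta> m x"
    by (simp_all add: inv_jacobi_ext_def m nat_add_distrib)
  show "2 * (real n + 1) * (real n - \<alpha> - \<beta> + 1) * (2 * real n - \<alpha> - \<beta>)
           * inv_jacobi_ext \<alpha> \<beta> (int n + 1) x
       - (2 * real n - \<alpha> - \<beta> + 1)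
           * ((2 * real n - \<alpha> - \<beta> + 2) * (2 * real n - \<alpha> - \<beta>) * x + \<alpha>\<^sup>2 - \<beta>\<^sup>2)
           * inv_jacobi_ext \<alpha> \<beta> (int n) x
       + 2 * (real n - \<alpha>) * (real n - \<beta>) * (2 * real n - \<alpha> - \<beta> + 2)
           * inv_jacobi_ext \<alpha> \<beta> (int n - 1) x = 0"
    using inv_jacobi_recurrence[of m \<alpha> \<beta>] unfolding ext by (simp add: m algebra_simps)
next
  fix x :: real assume x: "x \<in> {-1<..<1}"
  show "inv_jacobi_ext \<alpha> \<beta> 0 x = 1"
    using inv_jacobi_eq_poly[OF x, of \<alpha> \<beta> 0] by (simp add: inv_jacobi_ext_def)
  show "inv_jacobi_ext \<alpha> \<beta> (-1) x = 0"
    by (simp add: inv_jacobi_ext_def)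
next
  show "formally_self_adjoint (inv_jacobi_op \<alpha> \<beta>) {-1<..<1} (jacobi_measure (- \<alpha>) (- \<beta>))"
    by (rule inv_jacobi_op_self_adjoint)
next
  fix n and x :: real assume "x \<in> {-1<..<1}"
  then show "inv_jacobi_op \<alpha> \<beta> (inv_jacobi \<alpha> \<beta> n) x
         = - real n * (real n - \<alpha> - \<beta> + 1) * inv_jacobi \<alpha> \<beta> n x"
    by (rule inv_jacobi_eigenfunction)
qed

end
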